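(* Let $S(t)$ be an asymptotically compact semiflow on a complete metric space $X$, let $\mathscr{A}$ be an attractor of $S(t)$ with attraction basin $\Omega=\Omega(\mathscr{A})$ and Morse decomposition $\mathcal{M}=\{M_1,\dots,M_l\}$, and let $1\le k\le l$. Let $V,L$ be two strict Morse-Lyapunov functions of $\mathcal{M}$ on $\Omega$, and let $c=V(M_k)$, $c'=L(M_k)$. Assume $a<c<b$ and $\alpha<c'<\beta$ are such that $c$ and $c'$ are the unique generalized critical values of $V$ and $L$ in $[a,b]$ and $[\alpha,\beta]$, respectively. Then $$H_q(V_b,V_a)\cong H_q(L_\beta,L_\alpha),\qquad q=0,1,2,\dots.$$
   Context: $H_*$ denotes singular homology with coefficients in a given abelian group $\mathscr{G}$. $(X,d)$ is a complete metric space. $C(U)$ denotes the continuous real-valued functions on $U$. A semiflow on $X$ is a continuous map $S:[0,\infty)\times X\to X$, written $S(t)x=S(t,x)$, with $S(0)x=x$ and $S(t+s)x=S(t)S(s)x$ for all $t,s\ge 0$, $x\in X$. It is asymptotically compact if, whenever $(x_n)$ is a bounded sequence in $X$, $t_n\to+\infty$ and $(S(t_n)x_n)$ is bounded, the sequence $(S(t_n)x_n)$ has a convergent subsequence. For $A\subset X$ and $\varepsilon>0$, $B(A,\varepsilon)=\{y\in X: d(y,A)<\varepsilon\}$. A set $U$ is a neighborhood of $A$ if $\overline{A}\subset\operatorname{int}U$. $A$ attracts $B\subset X$ if for every $\varepsilon>0$ there is $T>0$ with $S(t)B\subset B(A,\varepsilon)$ for all $t>T$. $A$ is invariant if $S(t)A=A$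 for all $t\ge0$. An attractor is a compact invariant set that attracts some neighborhood of itself. The attraction basin of $A$ is $\Omega(A)=\{x: \lim_{t\to\infty}d(S(t)x,A)=0\}$ (an open set when $A$ is an attractor). Morse decompositions: let $\mathscr{A}$ be an attractor. A compact set $A\subset\mathscr{A}$ is an attractor of $S(t)$ in $\mathscr{A}$ if it is an attractor of the restriction of $S(t)$ to $\mathscr{A}$ (the empty set is allowed). Its dual repeller is $A^*=\{x\in\mathscr{A}:\omega(x)\cap A=\emptyset\}$, where $\omega(x)=\{y:\exists\,t_n\to+\infty,\ S(t_n)x\to y\}$. An ordered collection $\mathcal{M}=\{M_1,\dots,M_l\}$ of subsets of $\mathscr{A}$ is a Morse decomposition of $\mathscr{A}$, with Morse sets $M_k$, if there is a strictly increasing sequence $\emptyset=A_0\subsetneq A_1\subsetneq\cdots\subsetneq A_l=\mathscr{A}$ of attractors of $S(t)$ in $\mathscr{A}$ such that $M_k=A_k\cap A_{k-1}^*$ for $1\le k\le l$. Put $\mathcal{R}=\bigcup_{1\le k\le l}M_k$. A function $V\in C(\Omega)$ is a Morse-Lyapunov function of $\mathcal{M}$ on $\Omega$ if (1) $V$ is constant on each $M_k$ and (2) $t\mapsto V(S(t)x)$ is strictly decreasing in $t$ for each $x\in\Omega\setminus\mathcal{R}$. It is strict if in addition $V(M_1)<V(M_2)<\cdots<V(M_l)$, where $V(M_k)$ is the constant value of $V$ on $M_k$. The generalized critical values of $V$ are the numbers $V(M_k)$, $1\le k\le l$. For $a\in\mathbb{R}$, $V_a=\{x\in\Omega: V(x)\le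 a\}$ (similarly for $L$). *)

theory Defs
  imports "HOL-Analysis.Analysis" "HOL-Homology.Homology"
begin

section \<open>Singular homology with coefficients in an abelian group\<close>

text \<open>
  The library treats integral coefficients only. A chain with coefficients in the abelian group
  \<open>'g\<close> is a finitely supported map from singular simplices to \<open>'g\<close>. The definitions follow
  \<^theory>\<open>HOL-Homology.Simplices\<close> and \<^theory>\<open>HOL-Homology.Homology_Groups\<close>; for
  \<open>'g = int\<close> the library's groups are recovered, see \<open>relative_homology_group_coeff_int\<close> below.
\<close>

type_synonym ('a, 'g) coeff_chain = "((nat \<Rightarrow> real) \<Rightarrow> 'a) \<Rightarrow>\<^sub>0 'g"

definition coeff_chain_set :: "nat \<Rightarrow> 'a topology \<Rightarrow> ('a, 'g::ab_group_add) coeff_chain set" where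
  "coeff_chain_set p X = {c. Poly_Mapping.keys c \<subseteq> singular_simplex_set p X}"

text \<open>\<open>\<partial>(\<Sum> g\<^sub>f f) = \<Sum>\<^sub>f \<Sum>\<^sub>k (-1)\<^sup>k g\<^sub>f (k-th face of f)\<close>\<close>

definition coeff_boundary ::
    "nat \<Rightarrow> ('a, 'g::ab_group_add) coeff_chain \<Rightarrow> ('a, 'g) coeff_chain" where
  "coeff_boundary p c =
     (if p = 0 then 0
      else \<Sum>f\<in>Poly_Mapping.keys c. \<Sum>k\<le>p.
             Poly_Mapping.single (singular_face p k f)
               (if even k then Poly_Mapping.lookup c f else - Poly_Mapping.lookup c f))"

definition coeff_relcycle_set ::
    "nat \<Rightarrow> 'a topology \<Rightarrow> 'a set \<Rightarrow> ('a, 'g::ab_group_add) coeff_chain set" where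
  "coeff_relcycle_set p X A =
     {c \<in> coeff_chain_set p X. coeff_boundary p c \<in> coeff_chain_set (p - 1) (subtopology X A)}"

definition coeff_relboundary_set ::
    "nat \<Rightarrow> 'a topology \<Rightarrow> 'a set \<Rightarrow> ('a, 'g::ab_group_add) coeff_chain set" where
  "coeff_relboundary_set p X A =
     {c. \<exists>d \<in> coeff_chain_set (Suc p) X.
           coeff_boundary (Suc p) d - c \<in> coeff_chain_set p (subtopology X A)}"

definition coeff_relcycle_group ::
    "nat \<Rightarrow> 'a topology \<Rightarrow> 'a set \<Rightarrow> ('a, 'g::ab_group_add) coeff_chain monoid" where
  "coeff_relcycle_group p X A =
     \<lparr>carrier = coeff_relcycle_set p X A, monoid.mult = (+), one = 0\<rparr>"

definition relative_homology_group_coeff ::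
    "'g::ab_group_add itself \<Rightarrow> nat \<Rightarrow> 'a topology \<Rightarrow> 'a set \<Rightarrow> ('a, 'g) coeff_chain set monoid" where
  "relative_homology_group_coeff G p X A =
     coeff_relcycle_group p X A Mod coeff_relboundary_set p X A"

lemma coeff_boundary_int: "coeff_boundary p c = chain_boundary p (c :: 'a chain)"
proof -
  have "frag_cmul n (\<Sum>k\<le>p. frag_cmul ((-1) ^ k) (frag_of (singular_face p k f))) =
      (\<Sum>k\<le>p. Poly_Mapping.single (singular_face p k f) (if even k then n else - n))"
    for n and f :: "(nat \<Rightarrow> real) \<Rightarrow> 'a"
    unfolding frag_cmul_sum
    by (intro sum.cong refl poly_mapping_eqI) (auto simp: lookup_single when_def)
  then show ?thesis
    by (simp add: coeff_boundary_def chain_boundary_def frag_extend_def)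
qed

lemma relative_homology_group_coeff_int:
  "relative_homology_group_coeff TYPE(int) p X A = relative_homology_group (int p) X A"
proof -
  have ch: "coeff_chain_set q Y = singular_chain_set q Y" for q and Y :: "'a topology"
    by (auto simp: coeff_chain_set_def singular_chain_def)
  have cyc: "coeff_relcycle_set p X A = singular_relcycle_set p X A"
    by (auto simp: coeff_relcycle_set_def singular_relcycle_def mod_subset_def ch
        coeff_boundary_int)
  have bd: "coeff_relboundary_set p X A = singular_relboundary_set p X A"
    by (auto simp: coeff_relboundary_set_def singular_relboundary_def mod_subset_def ch
        coeff_boundary_int)
  have "relcycle_group p X A = coeff_relcycle_group p X A"
    by (rule monoid.equality) (simp_all add: coeff_relcycle_group_def cyc)
  then show ?thesis
    by (simp add: relative_homology_group_coeff_def relative_homology_group_def bd)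
qed


section \<open>Semiflows and attractors\<close>

text \<open>Only the values \<open>S t x\<close> with \<open>t \<ge> 0\<close> are meaningful.\<close>

definition semiflow :: "(real \<Rightarrow> 'a::metric_space \<Rightarrow> 'a) \<Rightarrow> bool" where
  "semiflow S \<longleftrightarrow>
     continuous_on ({0..} \<times> UNIV) (\<lambda>(t, x). S t x) \<and>
     (\<forall>x. S 0 x = x) \<and>
     (\<forall>t\<ge>0. \<forall>s\<ge>0. \<forall>x. S (t + s) x = S t (S s x))"

definition asymptotically_compact :: "(real \<Rightarrow> 'a::metric_space \<Rightarrow> 'a) \<Rightarrow> bool" where
  "asymptotically_compact S \<longleftrightarrow>
     (\<forall>x t. bounded (range x) \<and> (\<forall>n. 0 \<le> t n) \<and> filterlim t at_top sequentially \<and>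
            bounded (range (\<lambda>n. S (t n) (x n))) \<longrightarrow>
        (\<exists>r :: nat \<Rightarrow> nat. strict_mono r \<and> convergent (\<lambda>n. S (t (r n)) (x (r n)))))"

text \<open>
  The conjunct \<open>A \<noteq> {}\<close>, here and in the attraction basin, encodes \<open>d(y, \<emptyset>) = \<infinity>\<close>; the library has
  \<open>infdist y {} = 0\<close>.
\<close>

definition set_ball :: "'a::metric_space set \<Rightarrow> real \<Rightarrow> 'a set" where
  "set_ball A e = {y. A \<noteq> {} \<and> infdist y A < e}"

definition attracts :: "(real \<Rightarrow> 'a::metric_space \<Rightarrow> 'a) \<Rightarrow> 'a set \<Rightarrow> 'a set \<Rightarrow> bool" where
  "attracts S A B \<longleftrightarrow> (\<forall>e>0. \<exists>T>0. \<forall>t>T. S t ` B \<subseteq> set_ball A e)"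

definition flow_invariant :: "(real \<Rightarrow> 'a \<Rightarrow> 'a) \<Rightarrow> 'a set \<Rightarrow> bool" where
  "flow_invariant S A \<longleftrightarrow> (\<forall>t\<ge>0. S t ` A = A)"

definition neighborhood_in :: "'a::metric_space set \<Rightarrow> 'a set \<Rightarrow> 'a set \<Rightarrow> bool" where
  "neighborhood_in Y U A \<longleftrightarrow>
     U \<subseteq> Y \<and> top_of_set Y closure_of A \<subseteq> top_of_set Y interior_of U"

text \<open>
  \<open>attractor_in S Y A\<close>: \<open>A\<close> is an attractor of the restriction of \<open>S\<close> to the phase space \<open>Y\<close>.
  This is used for \<open>Y = UNIV\<close> and for invariant sets \<open>Y\<close>.
\<close>

definition attractor_in :: "(real \<Rightarrow> 'a::metric_space \<Rightarrow> 'a) \<Rightarrow> 'a set \<Rightarrow> 'a set \<Rightarrow> bool" where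
  "attractor_in S Y A \<longleftrightarrow>
     A \<subseteq> Y \<and> compact A \<and> flow_invariant S A \<and> (\<exists>U. neighborhood_in Y U A \<and> attracts S A U)"

abbreviation attractor :: "(real \<Rightarrow> 'a::metric_space \<Rightarrow> 'a) \<Rightarrow> 'a set \<Rightarrow> bool" where
  "attractor S A \<equiv> attractor_in S UNIV A"

definition attraction_basin :: "(real \<Rightarrow> 'a::metric_space \<Rightarrow> 'a) \<Rightarrow> 'a set \<Rightarrow> 'a set" where
  "attraction_basin S A = {x. A \<noteq> {} \<and> ((\<lambda>t. infdist (S t x) A) \<longlongrightarrow> 0) at_top}"


section \<open>Morse decompositions and Morse-Lyapunov functions\<close>

definition omega_limit :: "(real \<Rightarrow> 'a::metric_space \<Rightarrow> 'a) \<Rightarrow> 'a \<Rightarrow> 'a set" where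
  "omega_limit S x =
     {y. \<exists>t :: nat \<Rightarrow> real. (\<forall>n. 0 \<le> t n) \<and> filterlim t at_top sequentially \<and>
           (\<lambda>n. S (t n) x) \<longlonglongrightarrow> y}"

definition dual_repeller ::
    "(real \<Rightarrow> 'a::metric_space \<Rightarrow> 'a) \<Rightarrow> 'a set \<Rightarrow> 'a set \<Rightarrow> 'a set" where
  "dual_repeller S \<A> A = {x \<in> \<A>. omega_limit S x \<inter> A = {}}"

text \<open>The Morse sets are \<open>M 1, \<dots>, M l\<close>; the other values of \<open>M\<close> are irrelevant.\<close>

definition morse_decomposition ::
    "(real \<Rightarrow> 'a::metric_space \<Rightarrow> 'a) \<Rightarrow> 'a set \<Rightarrow> nat \<Rightarrow> (nat \<Rightarrow> 'a set) \<Rightarrow> bool" where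
  "morse_decomposition S \<A> l M \<longleftrightarrow>
     (\<exists>A :: nat \<Rightarrow> 'a set.
        A 0 = {} \<and> A l = \<A> \<and>
        (\<forall>k<l. A k \<subset> A (Suc k)) \<and>
        (\<forall>k\<le>l. attractor_in S \<A> (A k)) \<and>
        (\<forall>k\<in>{1..l}. M k = A k \<inter> dual_repeller S \<A> (A (k - 1))))"

definition morse_lyapunov ::
    "(real \<Rightarrow> 'a::metric_space \<Rightarrow> 'a) \<Rightarrow> nat \<Rightarrow> (nat \<Rightarrow> 'a set) \<Rightarrow> 'a set \<Rightarrow> ('a \<Rightarrow> real) \<Rightarrow> bool" where
  "morse_lyapunov S l M \<Omega> V \<longleftrightarrow>
     continuous_on \<Omega> V \<and>
     (\<forall>k\<in>{1..l}. V constant_on M k) \<and>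
     (\<forall>x \<in> \<Omega> - (\<Union>k\<in>{1..l}. M k). strict_antimono_on {0..} (\<lambda>t. V (S t x)))"

text \<open>
  The value of \<open>V\<close> on a set where it is constant. Morse sets are never empty, because the
  inclusions of the attractors in a Morse decomposition are strict.
\<close>

definition const_value :: "('a \<Rightarrow> real) \<Rightarrow> 'a set \<Rightarrow> real" where
  "const_value V N = the_elem (V ` N)"

definition strict_morse_lyapunov ::
    "(real \<Rightarrow> 'a::metric_space \<Rightarrow> 'a) \<Rightarrow> nat \<Rightarrow> (nat \<Rightarrow> 'a set) \<Rightarrow> 'a set \<Rightarrow> ('a \<Rightarrow> real) \<Rightarrow> bool" where
  "strict_morse_lyapunov S l M \<Omega> V \<longleftrightarrow>
     morse_lyapunov S l M \<Omega> V \<and> strict_mono_on {1..l} (\<lambda>k. const_value V (M k))"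

definition critical_values :: "nat \<Rightarrow> (nat \<Rightarrow> 'a set) \<Rightarrow> ('a \<Rightarrow> real) \<Rightarrow> real set" where
  "critical_values l M V = (\<lambda>k. const_value V (M k)) ` {1..l}"

definition sublevel :: "'a set \<Rightarrow> ('a \<Rightarrow> real) \<Rightarrow> real \<Rightarrow> 'a set" where
  "sublevel \<Omega> V a = {x \<in> \<Omega>. V x \<le> a}"

end

theory Submission
  imports Defs
begin

text \<open>
  Both sublevel pairs are compared with their intersection. Every forward orbit in \<open>\<Omega>\<close> has an
  \<open>\<omega>\<close>-limit point in a Morse set, and by strictness the Morse sets below level \<open>b\<close> of \<open>V\<close> are exactly
  those below level \<open>\<beta>\<close> of \<open>L\<close>, namely \<open>M\<^sub>1, \<dots>, M\<^sub>k\<close>; likewise for \<open>a\<close>, \<open>\<alpha>\<close> and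
  \<open>M\<^sub>1, \<dots>, M\<^bsub>k-1\<^esub>\<close>. Since Lyapunov functions decrease along orbits, the flow therefore pushes each
  compact subset of \<open>V\<^sub>b\<close> into \<open>V\<^sub>b \<inter> L\<^sub>\<beta>\<close> in finite time, and each compact subset of \<open>V\<^sub>a\<close> into
  \<open>V\<^sub>a \<inter> L\<^sub>\<alpha>\<close>. Singular chains have compact support, so the inclusion
  \<open>(V\<^sub>b \<inter> L\<^sub>\<beta>, V\<^sub>a \<inter> L\<^sub>\<alpha>) \<subseteq> (V\<^sub>b, V\<^sub>a)\<close> induces an isomorphism in homology; exchange \<open>V\<close> and \<open>L\<close>.
  Homotopy invariance with coefficients is obtained by extending integral chain identities linearly.
\<close>

section \<open>Linear extension to coefficient chains\<close>

text \<open>The multiple n g in an abelian group. \<open>nat\<close> sends negative integers to 0,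
  so at least one of the two sums is empty.\<close>

definition int_scale :: "int \<Rightarrow> 'g::ab_group_add \<Rightarrow> 'g" where
  "int_scale n g = (\<Sum>i<nat n. g) - (\<Sum>i<nat (- n). g)"

lemma int_scale_simps [simp]:
  "int_scale 0 g = 0" "int_scale 1 g = g" "int_scale n 0 = 0"
  by (simp_all add: int_scale_def)

lemma int_scale_minus_left: "int_scale (- n) g = - int_scale n g"
  by (simp add: int_scale_def)

lemma int_scale_add_right: "int_scale n (g + h) = int_scale n g + int_scale n h"
  by (simp add: int_scale_def sum.distrib)

lemma int_scale_succ: "int_scale (n + 1) g = int_scale n g + g"
proof (cases "n \<ge> 0")
  case True
  then show ?thesis
    by (simp add: int_scale_def nat_add_distrib add.commute)
next
  case False
  then have "nat (- n) = Suc (nat (- (n + 1)))"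
    by simp
  then have "(\<Sum>i<nat (- n). g) = (\<Sum>i<nat (- (n + 1)). g) + g"
    by simp
  with False show ?thesis
    by (simp add: int_scale_def)
qed

lemma int_scale_add_left: "int_scale (m + n) g = int_scale m g + int_scale n g"
proof (induction n rule: int_induct [where k = 0])
  case (step1 i)
  then show ?case
    using int_scale_succ [of "m + i" g] int_scale_succ [of i g] by (simp add: algebra_simps)
next
  case (step2 i)
  then show ?case
    using int_scale_succ [of "m + (i - 1)" g] int_scale_succ [of "i - 1" g]
    by (simp add: algebra_simps)
qed simp

lemma int_scale_diff_left: "int_scale (m - n) g = int_scale m g - int_scale n g"
  using int_scale_add_left [of m "- n" g] by (simp add: int_scale_minus_left)

text \<open>The elementary tensor z \<otimes> g, viewed as a chain with coefficients.\<close>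

definition chain_tensor :: "('a \<Rightarrow>\<^sub>0 int) \<Rightarrow> 'g::ab_group_add \<Rightarrow> 'a \<Rightarrow>\<^sub>0 'g" where
  "chain_tensor z g = Poly_Mapping.map (\<lambda>n. int_scale n g) z"

lemma lookup_chain_tensor [simp]:
  "Poly_Mapping.lookup (chain_tensor z g) f = int_scale (Poly_Mapping.lookup z f) g"
  by (simp add: chain_tensor_def map.rep_eq when_def)

lemma keys_chain_tensor: "Poly_Mapping.keys (chain_tensor z g) \<subseteq> Poly_Mapping.keys z"
  by (auto simp: in_keys_iff)

lemma chain_tensor_0 [simp]: "chain_tensor 0 g = 0" "chain_tensor z 0 = 0"
  by (auto intro!: poly_mapping_eqI)

lemma chain_tensor_diff_left: "chain_tensor (y - z) g = chain_tensor y g - chain_tensor z g"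
  by (auto intro!: poly_mapping_eqI simp: lookup_minus int_scale_diff_left)

lemma chain_tensor_add_left: "chain_tensor (y + z) g = chain_tensor y g + chain_tensor z g"
  by (auto intro!: poly_mapping_eqI simp: lookup_add int_scale_add_left)

lemma chain_tensor_add_right: "chain_tensor z (g + h) = chain_tensor z g + chain_tensor z h"
  by (auto intro!: poly_mapping_eqI simp: lookup_add int_scale_add_right)

lemma chain_tensor_frag_of [simp]: "chain_tensor (frag_of f) g = Poly_Mapping.single f g"
  by (auto intro!: poly_mapping_eqI simp: lookup_single when_def)

lemma chain_tensor_sum: "chain_tensor (\<Sum>i\<in>I. z i) g = (\<Sum>i\<in>I. chain_tensor (z i) g)"
  by (induction I rule: infinite_finite_induct) (simp_all add: chain_tensor_add_left)

text \<open>The map \<phi> \<otimes> id, where \<phi> is given on the generators of a free abelian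
  group. It carries integral chain operators over to coefficients.\<close>

definition coeff_extend :: "('b \<Rightarrow> 'a \<Rightarrow>\<^sub>0 int) \<Rightarrow> ('b \<Rightarrow>\<^sub>0 'g::ab_group_add) \<Rightarrow> 'a \<Rightarrow>\<^sub>0 'g" where
  "coeff_extend \<phi> c = (\<Sum>f\<in>Poly_Mapping.keys c. chain_tensor (\<phi> f) (Poly_Mapping.lookup c f))"

lemma coeff_extend_0 [simp]: "coeff_extend \<phi> 0 = 0"
  by (simp add: coeff_extend_def)

lemma coeff_extend_add: "coeff_extend \<phi> (c + d) = coeff_extend \<phi> c + coeff_extend \<phi> d"
  unfolding coeff_extend_def
  by (rule setsum_keys_plus_distrib) (simp_all add: chain_tensor_add_right)

lemma coeff_extend_minus: "coeff_extend \<phi> (- c) = - coeff_extend \<phi> c"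
  using coeff_extend_add [of \<phi> c "- c"] by (simp add: eq_neg_iff_add_eq_0 add.commute)

lemma coeff_extend_diff: "coeff_extend \<phi> (c - d) = coeff_extend \<phi> c - coeff_extend \<phi> d"
  using coeff_extend_add [of \<phi> c "- d"] by (simp add: coeff_extend_minus)

lemma coeff_extend_sum: "coeff_extend \<phi> (\<Sum>i\<in>I. c i) = (\<Sum>i\<in>I. coeff_extend \<phi> (c i))"
  by (induction I rule: infinite_finite_induct) (simp_all add: coeff_extend_add)

lemma coeff_extend_single [simp]:
  "coeff_extend \<phi> (Poly_Mapping.single f g) = chain_tensor (\<phi> f) g"
  by (simp add: coeff_extend_def)

lemma coeff_extend_chain_tensor:
  "coeff_extend \<phi> (chain_tensor z g) = chain_tensor (frag_extend \<phi> z) g"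
  using subset_UNIV
proof (induction z rule: frag_induction)
  case (diff a b)
  then show ?case
    by (simp add: chain_tensor_diff_left coeff_extend_diff frag_extend_diff)
qed simp_all

text \<open>Together with \<open>coeff_extend_cong\<close> this reduces an identity between
  operators with coefficients to an integral identity on each single simplex.\<close>

lemma coeff_extend_compose:
  "coeff_extend \<phi> (coeff_extend \<psi> c) = coeff_extend (\<lambda>f. frag_extend \<phi> (\<psi> f)) c"
  by (simp add: coeff_extend_def [of \<psi>] coeff_extend_def [of "\<lambda>f. frag_extend \<phi> (\<psi> f)"]
      coeff_extend_sum coeff_extend_chain_tensor)

lemma coeff_extend_diff_fun:
  "coeff_extend (\<lambda>f. \<phi> f - \<psi> f) c = coeff_extend \<phi> c - coeff_extend \<psi> c"
  by (simp add: coeff_extend_def chain_tensor_diff_left sum_subtractf)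

lemma coeff_extend_cong:
  "(\<And>f. f \<in> Poly_Mapping.keys c \<Longrightarrow> \<phi> f = \<psi> f) \<Longrightarrow> coeff_extend \<phi> c = coeff_extend \<psi> c"
  by (simp add: coeff_extend_def)

lemma coeff_extend_frag_of: "coeff_extend frag_of c = c"
proof (rule poly_mapping_eqI)
  fix f
  show "Poly_Mapping.lookup (coeff_extend frag_of c) f = Poly_Mapping.lookup c f"
    by (auto simp: coeff_extend_def lookup_sum lookup_single when_def in_keys_iff)
qed

lemma coeff_extend_in_chain_set:
  assumes "\<And>f. f \<in> Poly_Mapping.keys c \<Longrightarrow> singular_chain p X (\<phi> f)"
  shows "coeff_extend \<phi> c \<in> coeff_chain_set p X"
proof -
  have "Poly_Mapping.keys (coeff_extend \<phi> c) \<subseteq> (\<Union>f\<in>Poly_Mapping.keys c. Poly_Mapping.keys (\<phi> f))"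
    unfolding coeff_extend_def using keys_sum keys_chain_tensor by (smt (verit) UN_iff subset_iff)
  with assms show ?thesis
    by (fastforce simp: coeff_chain_set_def singular_chain_def)
qed

text \<open>The sign of a face passes from the integral chain to the coefficient. Boundary formulas
  can thus be checked over the integers.\<close>

lemma coeff_boundary_eq_extend:
  "coeff_boundary p c = coeff_extend (\<lambda>f. chain_boundary p (frag_of f)) c"
proof -
  have "chain_tensor (frag_cmul ((-1) ^ k) (frag_of f)) g =
      Poly_Mapping.single f (if even k then g else - g)"
    for k and f :: "(nat \<Rightarrow> real) \<Rightarrow> 'a" and g :: 'b
    by (auto intro!: poly_mapping_eqI
        simp: lookup_single when_def lookup_frag_cmul int_scale_minus_left)
  then show ?thesis
    by (simp add: coeff_boundary_def coeff_extend_def chain_boundary_of chain_tensor_sum)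
qed

section \<open>Prism operators\<close>

abbreviation simplex_space :: "nat \<Rightarrow> (nat \<Rightarrow> real) topology" where
  "simplex_space p \<equiv> subtopology (powertop_real UNIV) (standard_simplex p)"

abbreviation unit_cylinder :: "'a topology \<Rightarrow> (real \<times> 'a) topology" where
  "unit_cylinder X \<equiv> prod_topology (top_of_set {0..1}) X"

text \<open>Restricted because singular simplices are extensional on the standard simplex.\<close>

definition id_simplex :: "nat \<Rightarrow> (nat \<Rightarrow> real) chain" where
  "id_simplex p = frag_of (restrict id (standard_simplex p))"

text \<open>D stands for a chain filling the cylinder over the model simplex; it is pushed forward
  along id x f and then h. With h the identity the prism stays in the cylinder.\<close>

definition prism ::
    "nat \<Rightarrow> (real \<times> (nat \<Rightarrow> real)) chain \<Rightarrow> (real \<times> 'b \<Rightarrow> 'a) \<Rightarrow> ((nat \<Rightarrow> real) \<Rightarrow> 'b) \<Rightarrow> 'a chain" where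
  "prism p D h f = chain_map (Suc p) (\<lambda>(s, x). h (s, f x)) D"

text \<open>The boundary that the prism formula prescribes for the model simplex: top minus bottom
  minus the prism over the boundary, built from D one dimension lower. For p = 0 the boundary is 0
  by convention and D drops out.\<close>

definition prism_boundary ::
    "nat \<Rightarrow> (real \<times> (nat \<Rightarrow> real)) chain \<Rightarrow> (real \<times> (nat \<Rightarrow> real)) chain" where
  "prism_boundary p D =
     chain_map p (Pair 1) (id_simplex p) - chain_map p (Pair 0) (id_simplex p)
       - frag_extend (prism (p - 1) D (\<lambda>y. y)) (chain_boundary p (id_simplex p))"

lemma singular_chain_id_simplex: "singular_chain p (simplex_space p) (id_simplex p)"
  unfolding id_simplex_def singular_chain_of singular_simplex_def
  by (auto intro: continuous_map_eq [of _ _ id])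

text \<open>Straight-line contraction to the vertex \<open>?a\<close>: convexity keeps it in the
  simplex, and continuity is checked coordinatewise.\<close>

lemma contractible_simplex_space: "contractible_space (simplex_space p)"
proof -
  let ?a = "\<lambda>j::nat. if j = 0 then 1 else (0::real)"
  let ?h = "\<lambda>(t::real, x::nat \<Rightarrow> real) i. (1 - t) * x i + t * ?a i"
  have fst: "continuous_map (unit_cylinder (simplex_space p)) euclideanreal fst"
    by (rule continuous_map_into_fulltopology [OF continuous_map_fst])
  have coord: "continuous_map (simplex_space p) euclideanreal (\<lambda>x. x i)" for i
    by (intro continuous_map_from_subtopology continuous_map_product_projection) simp
  have snd: "continuous_map (unit_cylinder (simplex_space p)) euclideanreal (\<lambda>z. snd z i)" for i
    using continuous_map_compose [OF continuous_map_snd coord] by (simp add: o_def)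
  have "continuous_map (unit_cylinder (simplex_space p)) (powertop_real UNIV) ?h"
    unfolding continuous_map_componentwise_UNIV case_prod_unfold
    by (intro allI continuous_map_add continuous_map_real_mult continuous_map_diff
        continuous_map_canonical_const fst snd)
  moreover have "?h (t, x) \<in> standard_simplex p"
    if "0 \<le> t" "t \<le> 1" "x \<in> standard_simplex p" for t x
    using convex_standard_simplex [of x p ?a t] that by simp
  ultimately show ?thesis
    unfolding contractible_space_def homotopic_with_def
    by (intro exI [of _ ?a] exI [of _ ?h]) (auto simp: continuous_map_in_subtopology)
qed

text \<open>Homotopy invariance makes z homologous to its image under a constant map. That image
  lies in a one-point space, where cycles of positive degree bound.\<close>

lemma contractible_cycle_is_boundary:
  assumes "contractible_space X" and z: "singular_chain n X z" "chain_boundary n z = 0" and "n > 0"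
  obtains d where "singular_chain (Suc n) X d" "chain_boundary (Suc n) d = z"
proof -
  obtain a where a: "homotopic_with (\<lambda>x. True) X X id (\<lambda>x. a)"
    using assms(1) by (auto simp: contractible_space_def)
  have cyc: "singular_relcycle n X {} z"
    using z by (simp add: singular_cycle)
  have hom: "homologous_rel n X {} (chain_map n id z) (chain_map n (\<lambda>x. a) z)"
    by (rule homotopic_imp_homologous_rel_chain_maps [where T = "{}", OF _ cyc]) (use a in simp)
  have "singular_relboundary n X {} (chain_map n (\<lambda>x. a) z)"
  \<comment> \<open>The point \<open>a\<close> is known to lie in X only if X is nonempty; over the
    empty space the only chain is 0.\<close>
  proof (cases "topspace X = {}")
    case True
    with z have "z = 0"
      by (simp add: singular_chain_empty)
    then show ?thesis
      by simp
  next
    case False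
    have cont: "continuous_map X X (\<lambda>x. a)"
      using a homotopic_with_imp_continuous_maps by blast
    with False have aX: "a \<in> topspace X"
      by (auto simp: continuous_map_def)
    have "continuous_map X (subtopology X {a}) (\<lambda>x. a)"
      using cont by (simp add: continuous_map_in_subtopology)
    then have "singular_relcycle n (subtopology X {a}) {} (chain_map n (\<lambda>x. a) z)"
      by (intro singular_relcycle_chain_map [OF cyc]) auto
    then have "singular_relboundary n (subtopology X {a}) {} (chain_map n (\<lambda>x. a) z)"
      using singular_boundary_eq_cycle_singleton [of "subtopology X {a}" a n] aX \<open>n > 0\<close> by auto
    then show ?thesis
      unfolding singular_boundary by (auto simp: singular_chain_subtopology)
  qed
  with hom have "singular_relboundary n X {} (chain_map n id z)"
    unfolding homologous_rel_def using singular_relboundary_add by fastforce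
  then show thesis
    using that chain_map_ident [OF z(1)] by (auto simp: singular_boundary)
qed

section \<open>Naturality and boundary of prisms\<close>

lemma continuous_map_unit_cylinder:
  "continuous_map X Y f \<Longrightarrow> continuous_map (unit_cylinder X) (unit_cylinder Y) (\<lambda>(s, x). (s, f x))"
  unfolding continuous_map_pairwise case_prod_unfold
  by (auto simp: o_def intro: continuous_map_fst continuous_map_compose [OF continuous_map_snd, unfolded o_def])

lemma singular_chain_prism:
  assumes "singular_chain (Suc p) (unit_cylinder (simplex_space p)) D"
    and "singular_simplex p X f" and "continuous_map (unit_cylinder X) Y h"
  shows "singular_chain (Suc p) Y (prism p D h f)"
proof -
  have "continuous_map (simplex_space p) X f"
    using assms(2) by (simp add: singular_simplex_def)
  from continuous_map_compose [OF continuous_map_unit_cylinder [OF this] assms(3)]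
  show ?thesis
    unfolding prism_def by (intro singular_chain_chain_map [OF assms(1)]) (simp add: o_def case_prod_unfold)
qed

text \<open>Naturality of the prism: on a generator both sides push D forward along maps that agree
  on the cylinder.\<close>

lemma chain_map_frag_extend_prism:
  assumes D: "singular_chain (Suc p) (unit_cylinder (simplex_space p)) D"
  shows "chain_map (Suc p) (\<lambda>(s, x). h (s, f x)) (frag_extend (prism p D (\<lambda>y. y)) c)
    = frag_extend (prism p D h) (chain_map p f c)"
  using subset_UNIV
proof (induction c rule: frag_induction)
  case (one \<sigma>)
  have "chain_map (Suc p) (\<lambda>(s, x). h (s, f x)) (prism p D (\<lambda>y. y) \<sigma>) =
      chain_map (Suc p) ((\<lambda>(s, x). h (s, f x)) \<circ> (\<lambda>(s, x). (s, \<sigma> x))) D"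
    by (simp add: prism_def chain_map_compose)
  \<comment> \<open>\<open>simplex_map\<close> cuts the composite off outside the standard simplex,
    so agreement is available only on the cylinder, which carries D.\<close>
  also have "\<dots> = prism p D h (simplex_map p f \<sigma>)"
    unfolding prism_def by (rule chain_map_eq [OF D]) (auto simp: simplex_map_def)
  finally show ?case
    by simp
next
  case (diff a b)
  then show ?case
    by (simp add: frag_extend_diff chain_map_diff)
qed simp

text \<open>The model identity \<open>bd\<close> is pushed forward along (s, x) \<mapsto> h (s, f
  x). The condition on D' is guarded by p > 0 because p - 1 is 0 in degree 0, where the boundary
  term vanishes.\<close>

lemma chain_boundary_prism:
  assumes D: "singular_chain (Suc p) (unit_cylinder (simplex_space p)) D"
    and bd: "chain_boundary (Suc p) D = prism_boundary p D'"
    and D': "p > 0 \<Longrightarrow> singular_chain p (unit_cylinder (simplex_space (p - 1))) D'"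
    and f: "singular_simplex p X f"
  shows "chain_boundary (Suc p) (prism p D h f) =
    chain_map p (\<lambda>x. h (1, x)) (frag_of f) - chain_map p (\<lambda>x. h (0, x)) (frag_of f)
      - frag_extend (prism (p - 1) D' h) (chain_boundary p (frag_of f))"
proof -
  let ?g = "\<lambda>(s, x). h (s, f x)"
  have ends: "chain_map p ?g (chain_map p (Pair s) (id_simplex p)) = chain_map p (\<lambda>x. h (s, x)) (frag_of f)"
    for s
    by (simp add: id_simplex_def simplex_map_def, rule arg_cong [where f = frag_of]) (auto simp: restrict_def)
  have "chain_map p ?g (frag_extend (prism (p - 1) D' (\<lambda>y. y)) (chain_boundary p (id_simplex p))) =
      frag_extend (prism (p - 1) D' h) (chain_boundary p (frag_of f))"
  proof (cases "p = 0")
    case True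
    then show ?thesis
      by (simp add: chain_boundary_def)
  next
    case False
    \<comment> \<open>The simplex f is the image of the identity simplex under the map f, so its
      boundary is the image of the model boundary.\<close>
    have "chain_map (p - 1) f (chain_boundary p (id_simplex p)) =
        chain_boundary p (chain_map p f (id_simplex p))"
      by (simp add: chain_boundary_chain_map [OF singular_chain_id_simplex])
    also have "\<dots> = chain_boundary p (frag_of f)"
      unfolding id_simplex_def singular_simplex_chain_map_id [OF f] ..
    finally show ?thesis
      using chain_map_frag_extend_prism [OF _, of "p - 1" D' h f] D' False by simp
  qed
  moreover have "chain_boundary (Suc p) (prism p D h f) = chain_map p ?g (prism_boundary p D')"
    using chain_boundary_chain_map [OF D, of ?g] bd by (simp add: prism_def)
  ultimately show ?thesis
    by (simp only: prism_boundary_def chain_map_diff ends)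
qed

lemma chain_boundary_frag_extend_prism:
  assumes D: "singular_chain (Suc p) (unit_cylinder (simplex_space p)) D"
    and bd: "chain_boundary (Suc p) D = prism_boundary p D'"
    and D': "p > 0 \<Longrightarrow> singular_chain p (unit_cylinder (simplex_space (p - 1))) D'"
    and c: "singular_chain p X c"
  shows "chain_boundary (Suc p) (frag_extend (prism p D h) c) =
    chain_map p (\<lambda>x. h (1, x)) c - chain_map p (\<lambda>x. h (0, x)) c
      - frag_extend (prism (p - 1) D' h) (chain_boundary p c)"
  using c unfolding singular_chain_def
proof (induction c rule: frag_induction)
  case (one f)
  then show ?case
    using chain_boundary_prism [OF D bd D', of X f h] by simp
next
  case (diff a b)
  then show ?case
    by (simp add: frag_extend_diff chain_map_diff chain_boundary_diff)
qed simp

text \<open>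
  Acyclic models: \<open>prism_chain p\<close> is a chain on the cylinder over the standard simplex whose image
  under \<open>(s, x) \<mapsto> h (s, f x)\<close> is the prism over \<open>f\<close>. It exists because \<open>prism_boundary p\<close> of the
  previous one is a cycle in a contractible space. Only its boundary formula matters, so no
  triangulation is needed.
\<close>

primrec prism_chain :: "nat \<Rightarrow> (real \<times> (nat \<Rightarrow> real)) chain" where
  "prism_chain 0 = (SOME d. singular_chain (Suc 0) (unit_cylinder (simplex_space 0)) d \<and>
     chain_boundary (Suc 0) d = prism_boundary 0 0)"
| "prism_chain (Suc p) = (SOME d. singular_chain (Suc (Suc p)) (unit_cylinder (simplex_space (Suc p))) d \<and>
     chain_boundary (Suc (Suc p)) d = prism_boundary (Suc p) (prism_chain p))"

section \<open>Existence of the model prism chains, degree by degree\<close>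

lemma continuous_map_Pair_unit_cylinder:
  "s \<in> {0..1} \<Longrightarrow> continuous_map X (unit_cylinder X) (Pair s)"
  by (auto simp: continuous_map_pairwise o_def)

text \<open>Degree 0 is separate, since a 0-cycle in a contractible space need not bound. Here the
  identity of the cylinder is a homotopy between its two end inclusions.\<close>

lemma ex_chain_boundary_prism_boundary_0:
  "\<exists>d. singular_chain (Suc 0) (unit_cylinder (simplex_space 0)) d \<and>
     chain_boundary (Suc 0) d = prism_boundary 0 0"
proof -
  let ?U = "unit_cylinder (simplex_space 0)"
  have "homotopic_with (\<lambda>h. h \<in> {} \<rightarrow> {}) (simplex_space 0) ?U (Pair 0) (Pair 1)"
    unfolding homotopic_with_def by (intro exI [of _ id]) auto
  then have "homologous_rel 0 ?U {} (chain_map 0 (Pair 0) (id_simplex 0)) (chain_map 0 (Pair 1) (id_simplex 0))"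
    by (rule homotopic_imp_homologous_rel_chain_maps)
      (simp add: singular_cycle singular_chain_id_simplex chain_boundary_def)
  then have "homologous_rel 0 ?U {} (chain_map 0 (Pair 1) (id_simplex 0)) (chain_map 0 (Pair 0) (id_simplex 0))"
    using homologous_rel_sym by blast
  then show ?thesis
    by (auto simp: homologous_rel_def singular_boundary prism_boundary_def chain_boundary_def)
qed

text \<open>By the formula in degree p, the boundary of the prism over the model boundary is top
  minus bottom of that boundary. Hence \<open>prism_boundary (Suc p) D\<close> is a cycle, and it
  bounds because the cylinder is contractible.\<close>

lemma ex_chain_boundary_prism_boundary_Suc:
  assumes D: "singular_chain (Suc p) (unit_cylinder (simplex_space p)) D"
    and bd: "chain_boundary (Suc p) D = prism_boundary p D'"
    and D': "p > 0 \<Longrightarrow> singular_chain p (unit_cylinder (simplex_space (p - 1))) D'"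
  shows "\<exists>d. singular_chain (Suc (Suc p)) (unit_cylinder (simplex_space (Suc p))) d \<and>
     chain_boundary (Suc (Suc p)) d = prism_boundary (Suc p) D"
proof -
  let ?U = "unit_cylinder (simplex_space (Suc p))"
  let ?i = "id_simplex (Suc p)"
  have bi: "singular_chain p (simplex_space (Suc p)) (chain_boundary (Suc p) ?i)"
    by (simp add: singular_chain_boundary_alt singular_chain_id_simplex)
  have ends: "singular_chain (Suc p) ?U (chain_map (Suc p) (Pair s) ?i)" if "s \<in> {0..1}" for s
    by (rule singular_chain_chain_map [OF singular_chain_id_simplex
          continuous_map_Pair_unit_cylinder [OF that]])
  have "singular_chain (Suc p) ?U (frag_extend (prism p D (\<lambda>y. y)) (chain_boundary (Suc p) ?i))"
  proof (intro singular_chain_extend singular_chain_prism [OF D])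
    show "singular_simplex p (simplex_space (Suc p)) f"
      if "f \<in> Poly_Mapping.keys (chain_boundary (Suc p) ?i)" for f
      using bi that by (auto simp: singular_chain_def)
  qed simp
  then have sing: "singular_chain (Suc p) ?U (prism_boundary (Suc p) D)"
    using ends by (simp add: prism_boundary_def singular_chain_diff)
  \<comment> \<open>The remaining term of the formula is the prism over the boundary of a boundary,
    which is 0.\<close>
  have "chain_boundary (Suc p) (frag_extend (prism p D (\<lambda>y. y)) (chain_boundary (Suc p) ?i)) =
      chain_map p (Pair 1) (chain_boundary (Suc p) ?i) - chain_map p (Pair 0) (chain_boundary (Suc p) ?i)"
    using chain_boundary_frag_extend_prism [OF D bd D' bi, of "\<lambda>y. y"]
      chain_boundary_boundary_alt [OF singular_chain_id_simplex]
    by simp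
  then have "chain_boundary (Suc p) (prism_boundary (Suc p) D) = 0"
    by (simp add: prism_boundary_def chain_boundary_diff
        chain_boundary_chain_map [OF singular_chain_id_simplex])
  moreover have "contractible_space ?U"
    by (simp add: contractible_space_prod_topology contractible_simplex_space
        convex_imp_contractible)
  ultimately show ?thesis
    using contractible_cycle_is_boundary [OF _ sing] by blast
qed

lemma prism_chain:
  "singular_chain (Suc p) (unit_cylinder (simplex_space p)) (prism_chain p)"
  "chain_boundary (Suc p) (prism_chain p) = prism_boundary p (prism_chain (p - 1))"
proof -
  \<comment> \<open>The third conjunct strengthens the induction: the step to the next degree also
    needs the previous model to be a chain in its own cylinder.\<close>
  have "singular_chain (Suc p) (unit_cylinder (simplex_space p)) (prism_chain p) \<and>
      chain_boundary (Suc p) (prism_chain p) = prism_boundary p (prism_chain (p - 1)) \<and>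
      (p > 0 \<longrightarrow> singular_chain p (unit_cylinder (simplex_space (p - 1))) (prism_chain (p - 1)))"
  proof (induction p)
    case 0
    \<comment> \<open>At p = 0 the index p - 1 is again 0, so the claim has
      \<open>prism_chain 0\<close> on both sides; the value of \<open>prism_boundary 0\<close> is
      the same for every D.\<close>
    have "prism_boundary 0 D = prism_boundary 0 0" for D
      by (simp add: prism_boundary_def chain_boundary_def)
    then show ?case
      using someI_ex [OF ex_chain_boundary_prism_boundary_0] by (metis (no_types, lifting) less_irrefl prism_chain.simps(1))
  next
    case (Suc p)
    then show ?case
      using someI_ex [OF ex_chain_boundary_prism_boundary_Suc [of p "prism_chain p"]] by simp
  qed
  then show "singular_chain (Suc p) (unit_cylinder (simplex_space p)) (prism_chain p)"
    "chain_boundary (Suc p) (prism_chain p) = prism_boundary p (prism_chain (p - 1))"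
    by auto
qed

section \<open>Relative homology with coefficients\<close>

definition coeff_chain_map ::
    "nat \<Rightarrow> ('b \<Rightarrow> 'a) \<Rightarrow> ('b, 'g::ab_group_add) coeff_chain \<Rightarrow> ('a, 'g) coeff_chain" where
  "coeff_chain_map p g = coeff_extend (\<lambda>f. frag_of (simplex_map p g f))"

section \<open>Algebra of chains, boundaries and induced maps with coefficients\<close>

lemma coeff_chain_set_add:
  "c \<in> coeff_chain_set p X \<Longrightarrow> d \<in> coeff_chain_set p X \<Longrightarrow> c + d \<in> coeff_chain_set p X"
  using keys_add [of c d] by (auto simp: coeff_chain_set_def)

lemma coeff_chain_set_minus: "- c \<in> coeff_chain_set p X \<longleftrightarrow> c \<in> coeff_chain_set p X"
  by (simp add: coeff_chain_set_def)

lemma coeff_chain_set_diff: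
  "c \<in> coeff_chain_set p X \<Longrightarrow> d \<in> coeff_chain_set p X \<Longrightarrow> c - d \<in> coeff_chain_set p X"
  using coeff_chain_set_add [of c p X "- d"] by (simp add: coeff_chain_set_minus)

lemma coeff_chain_set_0: "0 \<in> coeff_chain_set p X"
  by (simp add: coeff_chain_set_def)

lemma coeff_chain_set_mono:
  "S \<subseteq> T \<Longrightarrow> coeff_chain_set p (subtopology X S) \<subseteq> coeff_chain_set p (subtopology X T)"
  unfolding coeff_chain_set_def using singular_simplex_mono by fastforce

lemma coeff_boundary_0 [simp]: "coeff_boundary p 0 = 0"
  by (simp add: coeff_boundary_eq_extend)

lemma coeff_boundary_add: "coeff_boundary p (c + d) = coeff_boundary p c + coeff_boundary p d"
  by (simp add: coeff_boundary_eq_extend coeff_extend_add)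

lemma coeff_boundary_minus: "coeff_boundary p (- c) = - coeff_boundary p c"
  by (simp add: coeff_boundary_eq_extend coeff_extend_minus)

lemma coeff_boundary_diff: "coeff_boundary p (c - d) = coeff_boundary p c - coeff_boundary p d"
  by (simp add: coeff_boundary_eq_extend coeff_extend_diff)

lemma coeff_chain_map_diff:
  "coeff_chain_map p g (c - d) = coeff_chain_map p g c - coeff_chain_map p g d"
  by (simp add: coeff_chain_map_def coeff_extend_diff)

lemma frag_extend_chain_boundary:
  "frag_extend (\<lambda>f. chain_boundary p (frag_of f)) z = chain_boundary p z"
  using subset_UNIV
proof (induction z rule: frag_induction)
  case (diff a b)
  then show ?case
    by (simp add: frag_extend_diff chain_boundary_diff)
qed simp_all

lemma singular_chain_keys:
  assumes "c \<in> coeff_chain_set p X" and "f \<in> Poly_Mapping.keys c"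
  shows "singular_chain p X (frag_of f)"
  using assms by (auto simp: coeff_chain_set_def singular_chain_of)

lemma coeff_boundary_in_chain_set:
  assumes "c \<in> coeff_chain_set p X"
  shows "coeff_boundary p c \<in> coeff_chain_set (p - 1) X"
  unfolding coeff_boundary_eq_extend
  using singular_chain_boundary [OF singular_chain_keys [OF assms]]
  by (intro coeff_extend_in_chain_set) simp

lemma coeff_boundary_boundary:
  assumes "c \<in> coeff_chain_set p X"
  shows "coeff_boundary (p - 1) (coeff_boundary p c) = 0"
proof -
  have "coeff_boundary (p - 1) (coeff_boundary p c) = coeff_extend (\<lambda>f. 0) c"
    unfolding coeff_boundary_eq_extend coeff_extend_compose frag_extend_chain_boundary
    using chain_boundary_boundary [OF singular_chain_keys [OF assms]]
    by (intro coeff_extend_cong) simp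
  then show ?thesis
    by (simp add: coeff_extend_def)
qed

lemma coeff_chain_map_in_chain_set:
  assumes "c \<in> coeff_chain_set p X" and "continuous_map X Y g"
  shows "coeff_chain_map p g c \<in> coeff_chain_set p Y"
  unfolding coeff_chain_map_def
  using assms singular_simplex_simplex_map [OF _ assms(2)]
  by (intro coeff_extend_in_chain_set) (auto simp: coeff_chain_set_def singular_chain_of)

lemma coeff_chain_map_id_gen:
  assumes c: "c \<in> coeff_chain_set p X" and "\<And>x. x \<in> topspace X \<Longrightarrow> g x = x"
  shows "coeff_chain_map p g c = c"
proof -
  have "coeff_chain_map p g c = coeff_extend frag_of c"
    unfolding coeff_chain_map_def
    using c simplex_map_id_gen [OF _ assms(2)]
    by (intro coeff_extend_cong) (auto simp: coeff_chain_set_def)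
  then show ?thesis
    by (simp add: coeff_extend_frag_of)
qed

lemma coeff_boundary_chain_map:
  assumes "c \<in> coeff_chain_set p X"
  shows "coeff_boundary p (coeff_chain_map p g c) = coeff_chain_map (p - 1) g (coeff_boundary p c)"
  unfolding coeff_boundary_eq_extend coeff_chain_map_def coeff_extend_compose
proof (rule coeff_extend_cong)
  fix f
  assume "f \<in> Poly_Mapping.keys c"
  from chain_boundary_chain_map [OF singular_chain_keys [OF assms this], of g]
  show "frag_extend (\<lambda>f. chain_boundary p (frag_of f)) (frag_of (simplex_map p g f)) =
      frag_extend (\<lambda>f. frag_of (simplex_map (p - 1) g f)) (chain_boundary p (frag_of f))"
    by (simp add: chain_map_def o_def)
qed

text \<open>The chain homotopy formula with coefficients. Both sides become single linear
  extensions, which agree on each simplex by \<open>chain_boundary_prism\<close>.\<close>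

lemma coeff_boundary_prism:
  assumes c: "c \<in> coeff_chain_set p X"
  shows "coeff_boundary (Suc p) (coeff_extend (prism p (prism_chain p) h) c) =
    coeff_chain_map p (\<lambda>x. h (1, x)) c - coeff_chain_map p (\<lambda>x. h (0, x)) c
      - coeff_extend (prism (p - 1) (prism_chain (p - 1)) h) (coeff_boundary p c)"
proof -
  have "p > 0 \<Longrightarrow> singular_chain p (unit_cylinder (simplex_space (p - 1))) (prism_chain (p - 1))"
    using prism_chain(1) [of "p - 1"] by simp
  note * = chain_boundary_prism [OF prism_chain this, of X _ h]
  show ?thesis
    unfolding coeff_boundary_eq_extend coeff_chain_map_def coeff_extend_compose
      coeff_extend_diff_fun [symmetric] frag_extend_chain_boundary
    by (rule coeff_extend_cong) (use c * in \<open>auto simp: coeff_chain_set_def\<close>)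
qed

text \<open>Homotopy invariance for pairs: the prism over c bounds the difference up to the prism
  over the boundary of c, which lies in B because h maps the cylinder over A into B.\<close>

lemma homotopy_coeff_relboundary:
  assumes h: "continuous_map (unit_cylinder X) Y h"
    and hA: "\<And>s x. s \<in> {0..1} \<Longrightarrow> x \<in> A \<Longrightarrow> h (s, x) \<in> B"
    and c: "c \<in> coeff_relcycle_set p X A"
  shows "coeff_chain_map p (\<lambda>x. h (1, x)) c - coeff_chain_map p (\<lambda>x. h (0, x)) c
    \<in> coeff_relboundary_set p Y B"
proof -
  define d where "d = coeff_extend (prism p (prism_chain p) h) c"
  define e where "e = coeff_extend (prism (p - 1) (prism_chain (p - 1)) h) (coeff_boundary p c)"
  have c': "c \<in> coeff_chain_set p X" and bc: "coeff_boundary p c \<in> coeff_chain_set (p - 1) (subtopology X A)"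
    using c by (auto simp: coeff_relcycle_set_def)
  have "d \<in> coeff_chain_set (Suc p) Y"
    unfolding d_def using c'
    by (intro coeff_extend_in_chain_set singular_chain_prism [OF prism_chain(1) _ h])
      (auto simp: coeff_chain_set_def)
  moreover have "e \<in> coeff_chain_set p (subtopology Y B)"
  proof (cases "p = 0")
    case True
    then show ?thesis
      by (simp add: e_def coeff_boundary_def coeff_chain_set_0)
  next
    case False
    have "continuous_map (unit_cylinder (subtopology X A)) (subtopology Y B) h"
      using continuous_map_from_subtopology [OF h, of "{0..1} \<times> A"] hA
      by (auto simp: continuous_map_in_subtopology prod_topology_subtopology)
    from singular_chain_prism [OF prism_chain(1) _ this, of "p - 1"]
    show ?thesis
      unfolding e_def using bc False
      by (intro coeff_extend_in_chain_set) (auto simp: coeff_chain_set_def)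
  qed
  moreover have "coeff_boundary (Suc p) d -
      (coeff_chain_map p (\<lambda>x. h (1, x)) c - coeff_chain_map p (\<lambda>x. h (0, x)) c) = - e"
    unfolding d_def e_def coeff_boundary_prism [OF c'] by simp
  ultimately show ?thesis
    unfolding coeff_relboundary_set_def using coeff_chain_set_minus by fastforce
qed

section \<open>The groups of relative cycles, boundaries and homology classes\<close>

lemma coeff_relcycle_set_add:
  "c \<in> coeff_relcycle_set p X A \<Longrightarrow> d \<in> coeff_relcycle_set p X A \<Longrightarrow> c + d \<in> coeff_relcycle_set p X A"
  by (simp add: coeff_relcycle_set_def coeff_boundary_add coeff_chain_set_add)

lemma coeff_relcycle_set_minus:
  "c \<in> coeff_relcycle_set p X A \<Longrightarrow> - c \<in> coeff_relcycle_set p X A"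
  by (simp add: coeff_relcycle_set_def coeff_boundary_minus coeff_chain_set_minus)

lemma coeff_relcycle_set_0: "0 \<in> coeff_relcycle_set p X A"
  by (simp add: coeff_relcycle_set_def coeff_chain_set_0)

lemma coeff_relboundary_set_add:
  assumes "c \<in> coeff_relboundary_set p X A" and "d \<in> coeff_relboundary_set p X A"
  shows "c + d \<in> coeff_relboundary_set p X A"
proof -
  obtain u v where "u \<in> coeff_chain_set (Suc p) X" "v \<in> coeff_chain_set (Suc p) X"
    and "coeff_boundary (Suc p) u - c \<in> coeff_chain_set p (subtopology X A)"
      "coeff_boundary (Suc p) v - d \<in> coeff_chain_set p (subtopology X A)"
    using assms by (auto simp: coeff_relboundary_set_def)
  then show ?thesis
    using coeff_chain_set_add [of "coeff_boundary (Suc p) u - c" p _ "coeff_boundary (Suc p) v - d"]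
    unfolding coeff_relboundary_set_def
    by (intro CollectI bexI [of _ "u + v"]) (auto simp: coeff_boundary_add coeff_chain_set_add algebra_simps)
qed

lemma coeff_relboundary_set_minus:
  assumes "c \<in> coeff_relboundary_set p X A"
  shows "- c \<in> coeff_relboundary_set p X A"
proof -
  obtain u where "u \<in> coeff_chain_set (Suc p) X"
    and "coeff_boundary (Suc p) u - c \<in> coeff_chain_set p (subtopology X A)"
    using assms by (auto simp: coeff_relboundary_set_def)
  then show ?thesis
    using coeff_chain_set_minus [of "coeff_boundary (Suc p) u - c"]
    unfolding coeff_relboundary_set_def
    by (intro CollectI bexI [of _ "- u"]) (auto simp: coeff_boundary_minus coeff_chain_set_minus algebra_simps)
qed

lemma coeff_relboundary_set_diff:
  "c \<in> coeff_relboundary_set p X A \<Longrightarrow> d \<in> coeff_relboundary_set p X A \<Longrightarrow>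
    c - d \<in> coeff_relboundary_set p X A"
  using coeff_relboundary_set_add [of c p X A "- d"] by (simp add: coeff_relboundary_set_minus)

lemma coeff_relboundary_set_0: "0 \<in> coeff_relboundary_set p X A"
  unfolding coeff_relboundary_set_def
  by (intro CollectI bexI [of _ 0]) (simp_all add: coeff_chain_set_0)

text \<open>Modulo a chain in A, c is a boundary, and the boundary of a boundary is 0.\<close>

lemma coeff_relboundary_imp_relcycle: "coeff_relboundary_set p X A \<subseteq> coeff_relcycle_set p X A"
proof
  fix c :: "('a, 'b) coeff_chain"
  assume "c \<in> coeff_relboundary_set p X A"
  then obtain u where u: "u \<in> coeff_chain_set (Suc p) X"
    and e: "coeff_boundary (Suc p) u - c \<in> coeff_chain_set p (subtopology X A)"
    by (auto simp: coeff_relboundary_set_def)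
  have bu: "coeff_boundary (Suc p) u \<in> coeff_chain_set p X"
    using coeff_boundary_in_chain_set [OF u] by simp
  have "coeff_boundary (Suc p) u - c \<in> coeff_chain_set p X"
    using e coeff_chain_set_mono [of A UNIV p X] by auto
  from coeff_chain_set_diff [OF bu this] have "c \<in> coeff_chain_set p X"
    by simp
  moreover have "coeff_boundary p c = - coeff_boundary p (coeff_boundary (Suc p) u - c)"
    using coeff_boundary_boundary [OF u] by (simp add: coeff_boundary_diff)
  ultimately show "c \<in> coeff_relcycle_set p X A"
    using coeff_boundary_in_chain_set [OF e] by (simp add: coeff_relcycle_set_def coeff_chain_set_minus)
qed

lemma comm_group_coeff_relcycle_group: "comm_group (coeff_relcycle_group p X A)"
proof (rule comm_groupI)
  fix x :: "('a, 'b) coeff_chain"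
  assume "x \<in> carrier (coeff_relcycle_group p X A)"
  then show "\<exists>y\<in>carrier (coeff_relcycle_group p X A).
      y \<otimes>\<^bsub>coeff_relcycle_group p X A\<^esub> x = \<one>\<^bsub>coeff_relcycle_group p X A\<^esub>"
    by (intro bexI [of _ "- x"]) (simp_all add: coeff_relcycle_group_def coeff_relcycle_set_minus)
qed (simp_all add: coeff_relcycle_group_def coeff_relcycle_set_add coeff_relcycle_set_0 algebra_simps)

lemma inv_coeff_relcycle_group:
  assumes "c \<in> coeff_relcycle_set p X A"
  shows "inv\<^bsub>coeff_relcycle_group p X A\<^esub> c = - c"
proof -
  interpret comm_group "coeff_relcycle_group p X A :: ('a, 'b) coeff_chain monoid"
    by (rule comm_group_coeff_relcycle_group)
  show ?thesis
    by (rule inv_equality)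
      (use assms in \<open>simp_all add: coeff_relcycle_group_def coeff_relcycle_set_minus\<close>)
qed

lemma normal_coeff_relboundary_set:
  "coeff_relboundary_set p X A \<lhd> (coeff_relcycle_group p X A :: ('a, 'g::ab_group_add) coeff_chain monoid)"
proof -
  let ?G = "coeff_relcycle_group p X A :: ('a, 'g) coeff_chain monoid"
  interpret comm_group ?G
    by (rule comm_group_coeff_relcycle_group)
  have "subgroup (coeff_relboundary_set p X A) ?G"
  proof (rule subgroupI)
    show "coeff_relboundary_set p X A \<subseteq> carrier ?G"
      using coeff_relboundary_imp_relcycle by (auto simp: coeff_relcycle_group_def)
    then show "inv\<^bsub>?G\<^esub> c \<in> coeff_relboundary_set p X A" if "c \<in> coeff_relboundary_set p X A" for c
      using that coeff_relboundary_imp_relcycle inv_coeff_relcycle_group coeff_relboundary_set_minus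
      by (metis subsetD)
  qed (use coeff_relboundary_set_0 in \<open>auto simp: coeff_relcycle_group_def coeff_relboundary_set_add\<close>)
  then show ?thesis
    by (simp add: normal_iff_subgroup)
qed

lemma group_relative_homology_group_coeff:
  "group (relative_homology_group_coeff TYPE('g::ab_group_add) p X A)"
  unfolding relative_homology_group_coeff_def
  by (intro normal.factorgroup_is_group normal_coeff_relboundary_set)

text \<open>First isomorphism theorem for the map sending a cycle of the small pair to its class in
  the large one: \<open>surj\<close> makes it onto, and \<open>inj\<close> identifies its
  kernel.\<close>

lemma relative_homology_group_coeff_iso_subset:
  fixes X' X :: "'a topology"
  assumes sub: "coeff_relcycle_set p X' A' \<subseteq> (coeff_relcycle_set p X A :: ('a, 'g::ab_group_add) coeff_chain set)"
    and inj: "coeff_relcycle_set p X' A' \<inter> coeff_relboundary_set p X A =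
      (coeff_relboundary_set p X' A' :: ('a, 'g) coeff_chain set)"
    and surj: "\<And>z :: ('a, 'g) coeff_chain. z \<in> coeff_relcycle_set p X A \<Longrightarrow>
      \<exists>w \<in> coeff_relcycle_set p X' A'. z - w \<in> coeff_relboundary_set p X A"
  shows "relative_homology_group_coeff TYPE('g) p X' A' \<cong> relative_homology_group_coeff TYPE('g) p X A"
proof -
  let ?G' = "coeff_relcycle_group p X' A' :: ('a, 'g) coeff_chain monoid"
  let ?G = "coeff_relcycle_group p X A :: ('a, 'g) coeff_chain monoid"
  let ?N = "coeff_relboundary_set p X A :: ('a, 'g) coeff_chain set"
  let ?h = "\<lambda>z. ?N #>\<^bsub>?G\<^esub> z"
  interpret G': comm_group ?G'
    by (rule comm_group_coeff_relcycle_group)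
  interpret G: comm_group ?G
    by (rule comm_group_coeff_relcycle_group)
  interpret N: normal ?N ?G
    by (rule normal_coeff_relboundary_set)
  have carr: "z \<in> carrier ?G" if "z \<in> carrier ?G'" for z
    using that sub by (auto simp: coeff_relcycle_group_def)
  interpret h: group_hom ?G' "?G Mod ?N" ?h
  proof (intro group_hom.intro group_hom_axioms.intro homI G'.group_axioms N.factorgroup_is_group)
    fix y z
    assume "y \<in> carrier ?G'" "z \<in> carrier ?G'"
    moreover have "y \<otimes>\<^bsub>?G'\<^esub> z = y \<otimes>\<^bsub>?G\<^esub> z"
      by (simp add: coeff_relcycle_group_def)
    ultimately show "?h (y \<otimes>\<^bsub>?G'\<^esub> z) = ?h y \<otimes>\<^bsub>?G Mod ?N\<^esub> ?h z"
      by (simp add: carr N.rcos_sum)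
  qed (auto simp: carrier_FactGroup carr)
  have "?h ` carrier ?G' = carrier (?G Mod ?N)"
  proof (intro equalityI subsetI)
    fix C
    assume "C \<in> carrier (?G Mod ?N)"
    then obtain z where z: "z \<in> carrier ?G" "C = ?h z"
      by (auto simp: carrier_FactGroup)
    then obtain w where w: "w \<in> carrier ?G'" "z - w \<in> ?N"
      using surj by (auto simp: coeff_relcycle_group_def)
    have "z \<in> ?h w"
      using w by (auto simp: r_coset_def coeff_relcycle_group_def intro!: bexI [of _ "z - w"])
    then have "?h w = ?h z"
      using G.repr_independence [OF _ carr [OF w(1)] N.subgroup_axioms] by blast
    then show "C \<in> ?h ` carrier ?G'"
      using w z by auto
  qed auto
  moreover have "kernel ?G' (?G Mod ?N) ?h = coeff_relboundary_set p X' A'"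
  proof -
    have "?h z = ?N \<longleftrightarrow> z \<in> ?N" if "z \<in> carrier ?G'" for z
      using G.rcos_self [OF carr [OF that] N.subgroup_axioms] G.coset_join2 [OF carr [OF that] N.subgroup_axioms]
      by auto
    then show ?thesis
      by (auto simp: kernel_def one_FactGroup inj [symmetric] coeff_relcycle_group_def)
  qed
  ultimately show ?thesis
    using h.FactGroup_iso by (simp add: relative_homology_group_coeff_def)
qed

text \<open>K is the union of the images of the finitely many simplices that occur in c.\<close>

lemma coeff_chain_set_compact_support:
  fixes X :: "'a::topological_space set"
  assumes "c \<in> coeff_chain_set p (top_of_set X)"
  obtains K where "compact K" "K \<subseteq> X" "c \<in> coeff_chain_set p (top_of_set K)"
proof
  define K where "K = (\<Union>f\<in>Poly_Mapping.keys c. f ` standard_simplex p)"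
  have simp: "singular_simplex p (top_of_set X) f" if "f \<in> Poly_Mapping.keys c" for f
    using assms that by (auto simp: coeff_chain_set_def)
  have im: "compact (f ` standard_simplex p) \<and> f ` standard_simplex p \<subseteq> X"
    if "f \<in> Poly_Mapping.keys c" for f
  proof -
    have "compactin (simplex_space p) (standard_simplex p)"
      by (simp add: compactin_subtopology compactin_standard_simplex)
    then have "compactin (top_of_set X) (f ` standard_simplex p)"
      using simp [OF that] image_compactin unfolding singular_simplex_def by blast
    then show ?thesis
      by (simp add: compactin_subtopology)
  qed
  then show "compact K" "K \<subseteq> X"
    by (auto simp: K_def intro: compact_UN)
  have "f ` standard_simplex p \<subseteq> K" if "f \<in> Poly_Mapping.keys c" for f
    using that by (auto simp: K_def)
  then show "c \<in> coeff_chain_set p (top_of_set K)"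
    using simp by (auto simp: coeff_chain_set_def singular_simplex_subtopology)
qed

text \<open>
  A chain has compact support, so \<open>S t\<close> for large \<open>t\<close> carries it into the smaller pair; running the
  flow is a homotopy within each pair, so this does not change homology classes.
\<close>

lemma relative_homology_group_coeff_iso_absorbing:
  fixes X :: "'a::topological_space set" and S :: "real \<Rightarrow> 'a \<Rightarrow> 'a"
  assumes sub: "A' \<subseteq> X'" "A \<subseteq> X" "X' \<subseteq> X" "A' \<subseteq> A"
    and cont: "continuous_on ({0..} \<times> X) (\<lambda>(t, x). S t x)"
    and S0: "\<And>x. x \<in> X \<Longrightarrow> S 0 x = x"
    and inv: "\<And>Y t. Y \<in> {X, A, X', A'} \<Longrightarrow> 0 \<le> t \<Longrightarrow> S t ` Y \<subseteq> Y"
    and absX: "\<And>K. compact K \<Longrightarrow> K \<subseteq> X \<Longrightarrow> \<exists>T. \<forall>t\<ge>T. S t ` K \<subseteq> X'"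
    and absA: "\<And>K. compact K \<Longrightarrow> K \<subseteq> A \<Longrightarrow> \<exists>T. \<forall>t\<ge>T. S t ` K \<subseteq> A'"
  shows "relative_homology_group_coeff TYPE('g::ab_group_add) p (top_of_set X') A'
    \<cong> relative_homology_group_coeff TYPE('g) p (top_of_set X) A"
proof -
  have subtop: "subtopology (top_of_set X) A = top_of_set A"
    "subtopology (top_of_set X') A' = top_of_set A'"
    using sub by (simp_all add: subtopology_subtopology inf.absorb2)
  have mono: "coeff_chain_set n (top_of_set U) \<subseteq> coeff_chain_set n (top_of_set W)" if "U \<subseteq> W"
    for n U and W :: "'a set"
    using coeff_chain_set_mono [OF that] .
  have contS: "continuous_on Y (S t)" if "t \<ge> 0" "Y \<subseteq> X" for t Y
    using that continuous_on_compose2 [OF cont continuous_on_Pair [OF continuous_on_const continuous_on_id]]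
    by (auto simp: image_subset_iff)
  have push: "coeff_chain_map n (S t) c \<in> coeff_chain_set n (top_of_set W)"
    if "t \<ge> 0" "U \<subseteq> X" "S t ` U \<subseteq> W" "c \<in> coeff_chain_set n (top_of_set U)"
    for n t U W and c :: "('a, 'g) coeff_chain"
    using that contS by (intro coeff_chain_map_in_chain_set [OF that(4)]) (auto simp: image_subset_iff)
  \<comment> \<open>Absorption of compact sets becomes absorption of chains, applied to a compact
    support.\<close>
  have absorb: "\<exists>T. \<forall>t\<ge>T. coeff_chain_map n (S t) c \<in> coeff_chain_set n (top_of_set W)"
    if "U \<subseteq> X" and c: "c \<in> coeff_chain_set n (top_of_set U)"
      and abs: "\<And>K. compact K \<Longrightarrow> K \<subseteq> U \<Longrightarrow> \<exists>T. \<forall>t\<ge>T. S t ` K \<subseteq> W"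
    for n U W and c :: "('a, 'g) coeff_chain"
  proof -
    obtain K where K: "compact K" "K \<subseteq> U" "c \<in> coeff_chain_set n (top_of_set K)"
      using coeff_chain_set_compact_support [OF c] by blast
    obtain T where T: "\<forall>t\<ge>T. S t ` K \<subseteq> W"
      using abs [OF K(1,2)] by blast
    show ?thesis
      by (intro exI [of _ "max 0 T"] allI impI push [OF _ _ _ K(3)]) (use T K that in auto)
  qed
  have homotopy: "coeff_chain_map p (S t) c - c \<in> coeff_relboundary_set p (top_of_set Y) B"
    if "t \<ge> 0" "Y \<subseteq> X" "\<And>s. s \<ge> 0 \<Longrightarrow> S s ` Y \<subseteq> Y" "\<And>s. s \<ge> 0 \<Longrightarrow> S s ` B \<subseteq> B"
      and c: "c \<in> coeff_relcycle_set p (top_of_set Y) B"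
    for t Y B and c :: "('a, 'g) coeff_chain"
  proof -
    \<comment> \<open>The flow from time 0 to t, rescaled to the unit interval.\<close>
    let ?h = "\<lambda>(s, x). S (s * t) x"
    have "continuous_on ({0..1} \<times> Y) (\<lambda>z. (\<lambda>(s, x). S s x) (fst z * t, snd z))"
      by (rule continuous_on_compose2 [OF cont]) (use that in \<open>auto intro!: continuous_intros\<close>)
    then have "continuous_on ({0..1} \<times> Y) ?h"
      by (simp add: case_prod_unfold)
    then have "continuous_map (unit_cylinder (top_of_set Y)) (top_of_set Y) ?h"
      unfolding subtopology_Times [symmetric] prod_topology_euclidean
      using that(1,3) by (auto simp: image_subset_iff)
    from homotopy_coeff_relboundary [OF this, of B B c p] c that
    have "coeff_chain_map p (S t) c - coeff_chain_map p (S 0) c \<in> coeff_relboundary_set p (top_of_set Y) B"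
      by (auto simp: image_subset_iff)
    moreover have "coeff_chain_map p (S 0) c = c"
      by (rule coeff_chain_map_id_gen [of _ _ "top_of_set Y"])
        (use c S0 that in \<open>auto simp: coeff_relcycle_set_def\<close>)
    ultimately show ?thesis
      by simp
  qed
  show ?thesis
  proof (rule relative_homology_group_coeff_iso_subset)
    show cyc: "coeff_relcycle_set p (top_of_set X') A' \<subseteq>
        (coeff_relcycle_set p (top_of_set X) A :: ('a, 'g) coeff_chain set)"
      using mono [OF sub(3)] mono [OF sub(4)] by (auto simp: coeff_relcycle_set_def subtop)
    show "\<exists>w\<in>coeff_relcycle_set p (top_of_set X') A'. z - w \<in> coeff_relboundary_set p (top_of_set X) A"
      if z: "z \<in> coeff_relcycle_set p (top_of_set X) A" for z :: "('a, 'g) coeff_chain"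
    proof -
      have zX: "z \<in> coeff_chain_set p (top_of_set X)"
        and bz: "coeff_boundary p z \<in> coeff_chain_set (p - 1) (top_of_set A)"
        using z by (auto simp: coeff_relcycle_set_def subtop)
      obtain T1 where T1: "\<forall>t\<ge>T1. coeff_chain_map p (S t) z \<in> coeff_chain_set p (top_of_set X')"
        using absorb [OF order_refl zX absX] by blast
      obtain T2 where T2: "\<forall>t\<ge>T2. coeff_chain_map (p - 1) (S t) (coeff_boundary p z)
          \<in> coeff_chain_set (p - 1) (top_of_set A')"
        using absorb [OF sub(2) bz absA] by blast
      \<comment> \<open>One time must serve both z and its boundary.\<close>
      define t where "t = max 0 (max T1 T2)"
      define w where "w = coeff_chain_map p (S t) z"
      have "w \<in> coeff_relcycle_set p (top_of_set X') A'"
        using T1 T2 by (simp add: w_def t_def coeff_relcycle_set_def subtop coeff_boundary_chain_map [OF zX])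
      moreover have "w - z \<in> coeff_relboundary_set p (top_of_set X) A"
        unfolding w_def by (rule homotopy [OF _ _ _ _ z]) (use inv in \<open>auto simp: t_def\<close>)
      ultimately show ?thesis
        using coeff_relboundary_set_minus [of "w - z"] by (intro bexI [of _ w]) auto
    qed
    show "coeff_relcycle_set p (top_of_set X') A' \<inter> coeff_relboundary_set p (top_of_set X) A =
        (coeff_relboundary_set p (top_of_set X') A' :: ('a, 'g) coeff_chain set)"
    proof (intro equalityI subsetI)
      fix z :: "('a, 'g) coeff_chain"
      assume z: "z \<in> coeff_relboundary_set p (top_of_set X') A'"
      have "z \<in> coeff_relboundary_set p (top_of_set X) A"
        using z mono [OF sub(3)] mono [OF sub(4)] unfolding coeff_relboundary_set_def subtop by blast
      then show "z \<in> coeff_relcycle_set p (top_of_set X') A' \<inter> coeff_relboundary_set p (top_of_set X) A"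
        using z coeff_relboundary_imp_relcycle by blast
    next
      fix z :: "('a, 'g) coeff_chain"
      assume "z \<in> coeff_relcycle_set p (top_of_set X') A' \<inter> coeff_relboundary_set p (top_of_set X) A"
      then obtain d where z: "z \<in> coeff_relcycle_set p (top_of_set X') A'"
        and d: "d \<in> coeff_chain_set (Suc p) (top_of_set X)"
        and e: "coeff_boundary (Suc p) d - z \<in> coeff_chain_set p (top_of_set A)"
        by (auto simp: coeff_relboundary_set_def subtop)
      obtain T1 where T1: "\<forall>t\<ge>T1. coeff_chain_map (Suc p) (S t) d \<in> coeff_chain_set (Suc p) (top_of_set X')"
        using absorb [OF order_refl d absX] by blast
      obtain T2 where T2: "\<forall>t\<ge>T2. coeff_chain_map p (S t) (coeff_boundary (Suc p) d - z)
          \<in> coeff_chain_set p (top_of_set A')"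
        using absorb [OF sub(2) e absA] by blast
      define t where "t = max 0 (max T1 T2)"
      define w where "w = coeff_chain_map p (S t) z"
      \<comment> \<open>The pushed chain d lies in X' and bounds w modulo A'.\<close>
      have "coeff_chain_map p (S t) (coeff_boundary (Suc p) d - z) =
          coeff_boundary (Suc p) (coeff_chain_map (Suc p) (S t) d) - w"
        using coeff_boundary_chain_map [OF d, of "S t"] by (simp add: w_def coeff_chain_map_diff)
      moreover have "coeff_chain_map p (S t) (coeff_boundary (Suc p) d - z) \<in> coeff_chain_set p (top_of_set A')"
        "coeff_chain_map (Suc p) (S t) d \<in> coeff_chain_set (Suc p) (top_of_set X')"
        using T1 T2 by (simp_all add: t_def)
      ultimately have "w \<in> coeff_relboundary_set p (top_of_set X') A'"
        unfolding coeff_relboundary_set_def subtop by auto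
      \<comment> \<open>The homotopy runs inside the small pair, which the flow preserves; thus z
        bounds there along with w.\<close>
      moreover have "w - z \<in> coeff_relboundary_set p (top_of_set X') A'"
        unfolding w_def by (rule homotopy [OF _ _ _ _ z]) (use inv sub in \<open>auto simp: t_def\<close>)
      ultimately show "z \<in> coeff_relboundary_set p (top_of_set X') A'"
        using coeff_relboundary_set_diff [of w p "top_of_set X'" A' "w - z"] by simp
    qed
  qed
qed

section \<open>Lyapunov functions along orbits\<close>

lemma semiflow_add: "semiflow S \<Longrightarrow> 0 \<le> t \<Longrightarrow> 0 \<le> s \<Longrightarrow> S (t + s) x = S t (S s x)"
  by (simp add: semiflow_def)

lemma continuous_on_semiflow:
  assumes "semiflow S" and "0 \<le> t"
  shows "continuous_on Y (S t)"
proof -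
  have cont: "continuous_on ({0..} \<times> UNIV) (\<lambda>(t, x). S t x)"
    using assms(1) by (simp add: semiflow_def)
  show ?thesis
    using continuous_on_compose2 [OF cont continuous_on_Pair [OF continuous_on_const continuous_on_id]] assms(2)
    by (auto simp: image_subset_iff)
qed

lemma attraction_basin_forward_invariant:
  assumes "semiflow S" and "x \<in> attraction_basin S A" and "0 \<le> s"
  shows "S s x \<in> attraction_basin S A"
proof -
  have "((\<lambda>t. infdist (S (t + s) x) A) \<longlongrightarrow> 0) at_top"
    using assms(2) filterlim_compose [OF _ filterlim_at_top_mono [OF filterlim_ident, of "\<lambda>t. t + s"]] \<open>0 \<le> s\<close>
    by (auto simp: attraction_basin_def)
  moreover have "eventually (\<lambda>t. infdist (S (t + s) x) A = infdist (S t (S s x)) A) at_top"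
    using eventually_ge_at_top [of 0] by eventually_elim (use assms in \<open>simp add: semiflow_add\<close>)
  ultimately have "((\<lambda>t. infdist (S t (S s x)) A) \<longlongrightarrow> 0) at_top"
    by (rule Lim_transform_eventually)
  with assms(2) show ?thesis
    by (simp add: attraction_basin_def)
qed

lemma subset_attraction_basin:
  assumes "flow_invariant S A"
  shows "A \<subseteq> attraction_basin S A"
proof
  fix x
  assume "x \<in> A"
  have "S t x \<in> A" if "0 \<le> t" for t
    using assms \<open>x \<in> A\<close> that by (auto simp: flow_invariant_def)
  then have "eventually (\<lambda>t. infdist (S t x) A = 0) at_top"
    by (intro eventually_mono [OF eventually_ge_at_top [of 0]]) simp
  then show "x \<in> attraction_basin S A"
    using \<open>x \<in> A\<close> by (auto simp: attraction_basin_def intro: tendsto_eventually)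
qed

text \<open>Points of A nearest to S n x subconverge by compactness, and the orbit follows them
  because its distance to A tends to 0.\<close>

lemma omega_limit_meets_attractor:
  assumes "compact A" and "x \<in> attraction_basin S A"
  obtains y where "y \<in> omega_limit S x" "y \<in> A"
proof -
  have A: "A \<noteq> {}" and lim: "((\<lambda>t. infdist (S t x) A) \<longlongrightarrow> 0) at_top"
    using assms by (auto simp: attraction_basin_def)
  have "\<exists>z\<in>A. infdist (S (real n) x) A = dist (S (real n) x) z" for n
    using setdist_attains_inf [OF assms(1) A, of "{S (real n) x}"]
    by (metis infdist_eq_setdist infdist_singleton dist_commute)
  then obtain z where z: "\<And>n. z n \<in> A" "\<And>n. infdist (S (real n) x) A = dist (S (real n) x) (z n)"
    by metis
  obtain y r where y: "y \<in> A" "strict_mono r" "(z \<circ> r) \<longlonglongrightarrow> y"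
    using assms(1) [unfolded compact_def, rule_format, of z] z(1) by blast
  have r: "filterlim (\<lambda>n. real (r n)) at_top sequentially"
    using filterlim_compose [OF filterlim_real_sequentially filterlim_subseq [OF y(2)]] .
  have "(\<lambda>n. dist (S (real (r n)) x) (z (r n))) \<longlonglongrightarrow> 0"
    using filterlim_compose [OF lim r] by (simp add: z(2))
  moreover have "(\<lambda>n. dist (z (r n)) y) \<longlonglongrightarrow> 0"
    using y(3) by (simp add: o_def flip: tendsto_dist_iff)
  ultimately have "(\<lambda>n. dist (S (real (r n)) x) (z (r n)) + dist (z (r n)) y) \<longlonglongrightarrow> 0"
    using tendsto_add by fastforce
  then have "(\<lambda>n. dist (S (real (r n)) x) y) \<longlonglongrightarrow> 0"
    by (rule tendsto_sandwich [OF _ _ tendsto_const, rotated 2]) (simp_all add: dist_triangle)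
  then have "(\<lambda>n. S (real (r n)) x) \<longlonglongrightarrow> y"
    by (simp flip: tendsto_dist_iff)
  with r have "y \<in> omega_limit S x"
    unfolding omega_limit_def by (intro CollectI exI [of _ "\<lambda>n. real (r n)"]) auto
  with y that show thesis
    by blast
qed

lemma omega_limit_forward_subset:
  assumes "semiflow S" and "0 \<le> s"
  shows "omega_limit S (S s x) \<subseteq> omega_limit S x"
proof
  fix y
  assume "y \<in> omega_limit S (S s x)"
  then obtain t where t: "\<And>n. 0 \<le> t n" "filterlim t at_top sequentially" "(\<lambda>n. S (t n) (S s x)) \<longlonglongrightarrow> y"
    by (auto simp: omega_limit_def)
  then have "(\<lambda>n. S (t n + s) x) \<longlonglongrightarrow> y"
    using assms by (simp add: semiflow_add)
  moreover have "filterlim (\<lambda>n. t n + s) at_top sequentially"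
    using filterlim_tendsto_add_at_top [OF tendsto_const t(2), of s] by (simp add: add.commute)
  ultimately show "y \<in> omega_limit S x"
    unfolding omega_limit_def using t(1) assms(2)
    by (intro CollectI exI [of _ "\<lambda>n. t n + s"]) (auto simp: add_nonneg_nonneg)
qed

text \<open>A k is invariant, and moving along the orbit does not enlarge the \<omega>-limit set, so
  the dual repeller is not left.\<close>

lemma morse_set_forward_invariant:
  assumes "semiflow S" and "morse_decomposition S \<A> l M" and "k \<in> {1..l}"
    and x: "x \<in> M k" and t: "0 \<le> t"
  shows "S t x \<in> M k"
proof -
  obtain A where A: "\<forall>k\<le>l. attractor_in S \<A> (A k)"
      "\<forall>k\<in>{1..l}. M k = A k \<inter> dual_repeller S \<A> (A (k - 1))"
    using assms(2) by (auto simp: morse_decomposition_def)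
  then have Mk: "M k = A k \<inter> dual_repeller S \<A> (A (k - 1))" and inv: "flow_invariant S (A k)"
    and sub: "A k \<subseteq> \<A>"
    using assms(3) by (auto simp: attractor_in_def)
  have "S t x \<in> A k"
    using inv x t by (auto simp: Mk flow_invariant_def)
  then show ?thesis
    using x sub omega_limit_forward_subset [OF assms(1) t, of x] by (auto simp: Mk dual_repeller_def)
qed

section \<open>Monotonicity of Lyapunov functions along orbits\<close>

lemma const_value_eq:
  assumes "morse_lyapunov S l M \<Omega> V" and "k \<in> {1..l}" and "y \<in> M k"
  shows "const_value V (M k) = V y"
proof -
  have "V constant_on M k"
    using assms(1,2) by (simp add: morse_lyapunov_def)
  with assms(3) have "V ` M k = {V y}"
    by (auto simp: constant_on_def)
  then show ?thesis
    by (simp add: const_value_def)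
qed

text \<open>On a Morse set V is constant along the orbit, which stays in that set; elsewhere V
  decreases strictly.\<close>

lemma morse_lyapunov_decreasing:
  assumes "semiflow S" and "morse_decomposition S \<A> l M" and "morse_lyapunov S l M \<Omega> V"
    and "x \<in> \<Omega>" and "0 \<le> t"
  shows "V (S t x) \<le> V x"
proof (cases "x \<in> (\<Union>k\<in>{1..l}. M k)")
  case True
  then obtain k where k: "k \<in> {1..l}" "x \<in> M k"
    by blast
  then show ?thesis
    using const_value_eq [OF assms(3) k]
      const_value_eq [OF assms(3) k(1) morse_set_forward_invariant [OF assms(1,2) k assms(5)]] by simp
next
  case False
  with assms have "strict_antimono_on {0..} (\<lambda>t. V (S t x))"
    by (auto simp: morse_lyapunov_def)
  from monotone_onD [OF this, of 0 t] assms show ?thesis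
    by (cases "t = 0") (auto simp: semiflow_def)
qed

text \<open>LaSalle's principle: V is nonincreasing along the orbit and tends to V y along t n, so V
  y is a lower bound for V on the whole orbit.\<close>

lemma morse_lyapunov_omega_limit:
  assumes "semiflow S" and "morse_decomposition S \<A> l M"
    and lyap: "morse_lyapunov S l M (attraction_basin S \<A>) V"
    and x: "x \<in> attraction_basin S \<A>"
    and y: "y \<in> omega_limit S x" "y \<in> attraction_basin S \<A>"
  shows "V y \<le> V x" and "V y < b \<Longrightarrow> \<exists>t\<ge>0. V (S t x) < b"
    and "y \<in> (\<Union>k\<in>{1..l}. M k)"
proof -
  let ?\<Omega> = "attraction_basin S \<A>"
  obtain t where t: "\<And>n. 0 \<le> t n" "filterlim t at_top sequentially" "(\<lambda>n. S (t n) x) \<longlonglongrightarrow> y"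
    using y(1) by (auto simp: omega_limit_def)
  have cont: "continuous_on ?\<Omega> V"
    using lyap by (simp add: morse_lyapunov_def)
  note \<Omega> = attraction_basin_forward_invariant [OF assms(1)]
  note decr = morse_lyapunov_decreasing [OF assms(1,2) lyap]
  have anti: "V (S u x) \<le> V (S s x)" if "0 \<le> s" "s \<le> u" for s u
    using decr [OF \<Omega> [OF x that(1)], of "u - s"] semiflow_add [OF assms(1), of "u - s" s x] that by simp
  have lim: "(\<lambda>n. V (S (t n) x)) \<longlonglongrightarrow> V y"
    using continuous_on_tendsto_compose [OF cont t(3) y(2)] \<Omega> [OF x t(1)] by simp
  have le: "V y \<le> V (S s x)" if "0 \<le> s" for s
  proof (rule tendsto_upperbound [OF lim])
    show "eventually (\<lambda>n. V (S (t n) x) \<le> V (S s x)) sequentially"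
      using eventually_compose_filterlim [OF eventually_ge_at_top [of s] t(2)]
      by (rule eventually_mono) (use that anti in simp)
  qed simp
  show "V y \<le> V x"
    using le [of 0] assms(1) by (simp add: semiflow_def)
  show "\<exists>t\<ge>0. V (S t x) < b" if "V y < b"
    using order_tendstoD(2) [OF lim that] t(1) by (auto simp: eventually_sequentially)
  show "y \<in> (\<Union>k\<in>{1..l}. M k)"
  proof (rule ccontr)
    assume "y \<notin> (\<Union>k\<in>{1..l}. M k)"
    with lyap y(2) have "strict_antimono_on {0..} (\<lambda>t. V (S t y))"
      by (auto simp: morse_lyapunov_def)
    \<comment> \<open>Flowing for time 1 drops V strictly below V y. But S 1 y is a limit of orbit
      points, all at level at least V y by \<open>le\<close>.\<close>
    from monotone_onD [OF this, of 0 1] assms(1) have "V (S 1 y) < V y"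
      by (simp add: semiflow_def)
    moreover have "(\<lambda>n. V (S 1 (S (t n) x))) \<longlonglongrightarrow> V (S 1 y)"
    proof (rule continuous_on_tendsto_compose [OF cont])
      show "(\<lambda>n. S 1 (S (t n) x)) \<longlonglongrightarrow> S 1 y"
        using continuous_on_tendsto_compose [OF continuous_on_semiflow [OF assms(1), of 1 UNIV] t(3)] by simp
    qed (use \<Omega> x y t(1) in auto)
    moreover have "V y \<le> V (S 1 (S (t n) x))" for n
      using le [of "1 + t n"] t(1) [of n] by (simp add: semiflow_add [OF assms(1)])
    ultimately show False
      using LIMSEQ_le_const [of "\<lambda>n. V (S 1 (S (t n) x))" "V (S 1 y)" "V y"] by fastforce
  qed
qed

section \<open>Sublevel sets under the flow\<close>

lemma sublevel_forward_invariant: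
  assumes "semiflow S" and "morse_decomposition S \<A> l M"
    and "morse_lyapunov S l M (attraction_basin S \<A>) V"
    and "x \<in> sublevel (attraction_basin S \<A>) V b" and "0 \<le> t"
  shows "S t x \<in> sublevel (attraction_basin S \<A>) V b"
  using assms(4,5) morse_lyapunov_decreasing [OF assms(1-3), of x t]
    attraction_basin_forward_invariant [OF assms(1), of x \<A> t]
  by (auto simp: sublevel_def)

text \<open>Each point of K enters {L < \<beta>} at some time. The strict inequality persists
  nearby, so finitely many times suffice for K.\<close>

lemma sublevel_absorbs_compact:
  assumes "semiflow S" and "compact \<A>" "flow_invariant S \<A>" and "morse_decomposition S \<A> l M"
    and V: "morse_lyapunov S l M (attraction_basin S \<A>) V"
    and L: "morse_lyapunov S l M (attraction_basin S \<A>) L"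
    and crit: "\<And>k. k \<in> {1..l} \<Longrightarrow> const_value V (M k) \<le> b \<Longrightarrow> const_value L (M k) < \<beta>"
    and K: "compact K" "K \<subseteq> sublevel (attraction_basin S \<A>) V b"
  shows "\<exists>T. \<forall>t\<ge>T. S t ` K \<subseteq> sublevel (attraction_basin S \<A>) L \<beta>"
proof -
  let ?\<Omega> = "attraction_basin S \<A>"
  have "\<exists>t\<ge>0. L (S t x) < \<beta>" if "x \<in> K" for x
  proof -
    have x: "x \<in> ?\<Omega>" "V x \<le> b"
      using K that by (auto simp: sublevel_def)
    obtain y where y: "y \<in> omega_limit S x" "y \<in> \<A>"
      using omega_limit_meets_attractor [OF assms(2) x(1)] by blast
    then have y\<Omega>: "y \<in> ?\<Omega>"
      using subset_attraction_basin [OF assms(3)] by blast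
    obtain k where k: "k \<in> {1..l}" "y \<in> M k"
      using morse_lyapunov_omega_limit(3) [OF assms(1,4) V x(1) y(1) y\<Omega>] by blast
    have "V y \<le> b"
      using morse_lyapunov_omega_limit(1) [OF assms(1,4) V x(1) y(1) y\<Omega>] x by simp
    \<comment> \<open>The limit point y does not depend on the Lyapunov function: V puts its Morse
      set at level at most b, and \<open>crit\<close> transfers this to L.\<close>
    then have "L y < \<beta>"
      using crit [OF k(1)] const_value_eq [OF V k] const_value_eq [OF L k] by simp
    then show ?thesis
      using morse_lyapunov_omega_limit(2) [OF assms(1,4) L x(1) y(1) y\<Omega>] by blast
  qed
  then obtain \<tau> where \<tau>: "\<And>x. x \<in> K \<Longrightarrow> 0 \<le> \<tau> x" "\<And>x. x \<in> K \<Longrightarrow> L (S (\<tau> x) x) < \<beta>"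
    by metis
  let ?U = "\<lambda>x. {y \<in> K. L (S (\<tau> x) y) < \<beta>}"
  have K\<Omega>: "K \<subseteq> ?\<Omega>"
    using K by (auto simp: sublevel_def)
  have "openin (top_of_set K) (?U x)" if "x \<in> K" for x
  proof -
    have "continuous_on K (\<lambda>y. L (S (\<tau> x) y))"
      using L K\<Omega> attraction_basin_forward_invariant [OF assms(1)] \<tau>(1) [OF that]
      by (intro continuous_on_compose2 [of ?\<Omega> L _ "S (\<tau> x)"] continuous_on_semiflow [OF assms(1)])
        (auto simp: morse_lyapunov_def)
    from continuous_openin_preimage_gen [OF this open_lessThan [of \<beta>]] show ?thesis
      by (simp add: vimage_def Int_def)
  qed
  moreover have "K \<subseteq> (\<Union>x\<in>K. ?U x)"
    using \<tau>(2) by auto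
  ultimately have "\<exists>\<D>\<subseteq>?U ` K. finite \<D> \<and> K \<subseteq> \<Union>\<D>"
    by (intro K(1) [unfolded compact_eq_openin_cover, rule_format]) simp
  then obtain \<D> where \<D>: "\<D> \<subseteq> ?U ` K" "finite \<D>" "K \<subseteq> \<Union>\<D>"
    by blast
  obtain F where "F \<subseteq> K" "finite F" "\<D> = ?U ` F"
    using finite_subset_image [OF \<D>(2,1)] by blast
  with \<D>(3) have F: "finite F" "F \<subseteq> K" "K \<subseteq> (\<Union>x\<in>F. ?U x)"
    by simp_all
  \<comment> \<open>After the largest of the chosen times all of K has entered, and forward
    invariance keeps it there. The inserted 0 covers an empty F.\<close>
  have "S t y \<in> sublevel ?\<Omega> L \<beta>" if "y \<in> K" "Max (insert 0 (\<tau> ` F)) \<le> t" for t y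
  proof -
    from F(3) \<open>y \<in> K\<close> obtain x where x: "x \<in> F" "L (S (\<tau> x) y) < \<beta>"
      by blast
    have t: "\<tau> x \<le> t" "0 \<le> \<tau> x"
      using that x F \<tau>(1) by auto
    have "S (\<tau> x) y \<in> sublevel ?\<Omega> L \<beta>"
      using x t that K\<Omega> attraction_basin_forward_invariant [OF assms(1)] by (auto simp: sublevel_def)
    from sublevel_forward_invariant [OF assms(1,4) L this, of "t - \<tau> x"] t show ?thesis
      using semiflow_add [OF assms(1), of "t - \<tau> x" "\<tau> x" y] by simp
  qed
  then show ?thesis
    by blast
qed

text \<open>Levels of V are compared with levels of L only in one direction; exchanging V and L
  gives the other half of the main isomorphism.\<close>

lemma relative_homology_group_coeff_sublevel_Int_iso:
  fixes S :: "real \<Rightarrow> 'a::metric_space \<Rightarrow> 'a"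
  assumes "semiflow S" and "compact \<A>" "flow_invariant S \<A>" and "morse_decomposition S \<A> l M"
    and V: "morse_lyapunov S l M (attraction_basin S \<A>) V"
    and L: "morse_lyapunov S l M (attraction_basin S \<A>) L"
    and crit:
      "\<And>k. k \<in> {1..l} \<Longrightarrow> const_value V (M k) \<le> b \<Longrightarrow> const_value L (M k) < \<beta>"
      "\<And>k. k \<in> {1..l} \<Longrightarrow> const_value V (M k) \<le> a \<Longrightarrow> const_value L (M k) < \<alpha>"
    and "a \<le> b" "\<alpha> \<le> \<beta>"
  defines "\<Omega> \<equiv> attraction_basin S \<A>"
  shows "relative_homology_group_coeff TYPE('g::ab_group_add) q
      (top_of_set (sublevel \<Omega> V b \<inter> sublevel \<Omega> L \<beta>)) (sublevel \<Omega> V a \<inter> sublevel \<Omega> L \<alpha>)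
    \<cong> relative_homology_group_coeff TYPE('g) q (top_of_set (sublevel \<Omega> V b)) (sublevel \<Omega> V a)"
proof (rule relative_homology_group_coeff_iso_absorbing [of _ _ _ _ S])
  note invV = sublevel_forward_invariant [OF assms(1,4) V, folded \<Omega>_def]
  note invL = sublevel_forward_invariant [OF assms(1,4) L, folded \<Omega>_def]
  have absorb: "\<exists>T. \<forall>t\<ge>T. S t ` K \<subseteq> sublevel \<Omega> V r \<inter> sublevel \<Omega> L s"
    if rs: "\<And>k. k \<in> {1..l} \<Longrightarrow> const_value V (M k) \<le> r \<Longrightarrow> const_value L (M k) < s"
      and K: "compact K" "K \<subseteq> sublevel \<Omega> V r" for K r s
  proof -
    obtain T where T: "\<forall>t\<ge>T. S t ` K \<subseteq> sublevel \<Omega> L s"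
      using sublevel_absorbs_compact [OF assms(1-4) V L rs K [unfolded \<Omega>_def]] unfolding \<Omega>_def by blast
    then show ?thesis
      using invV K(2) by (intro exI [of _ "max 0 T"]) (auto simp: image_subset_iff)
  qed
  show "\<exists>T. \<forall>t\<ge>T. S t ` K \<subseteq> sublevel \<Omega> V b \<inter> sublevel \<Omega> L \<beta>"
    if "compact K" "K \<subseteq> sublevel \<Omega> V b" for K
    using absorb [OF crit(1) that] by blast
  show "\<exists>T. \<forall>t\<ge>T. S t ` K \<subseteq> sublevel \<Omega> V a \<inter> sublevel \<Omega> L \<alpha>"
    if "compact K" "K \<subseteq> sublevel \<Omega> V a" for K
    using absorb [OF crit(2) that] by blast
  show "continuous_on ({0..} \<times> sublevel \<Omega> V b) (\<lambda>(t, x). S t x)"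
    using assms(1) by (auto simp: semiflow_def intro: continuous_on_subset)
  show "S 0 x = x" for x
    using assms(1) by (simp add: semiflow_def)
  show "S t ` Y \<subseteq> Y"
    if Y: "Y \<in> {sublevel \<Omega> V b, sublevel \<Omega> V a, sublevel \<Omega> V b \<inter> sublevel \<Omega> L \<beta>,
        sublevel \<Omega> V a \<inter> sublevel \<Omega> L \<alpha>}" and t: "0 \<le> t" for Y t
    using Y invV [OF _ t] invL [OF _ t] by blast
  show "sublevel \<Omega> V a \<inter> sublevel \<Omega> L \<alpha> \<subseteq> sublevel \<Omega> V b \<inter> sublevel \<Omega> L \<beta>"
    "sublevel \<Omega> V a \<subseteq> sublevel \<Omega> V b"
    using \<open>a \<le> b\<close> \<open>\<alpha> \<le> \<beta>\<close> by (auto simp: sublevel_def)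
qed simp_all

theorem proposition6p4:
  fixes S :: "real \<Rightarrow> 'a::complete_space \<Rightarrow> 'a"
    and \<A> \<Omega> :: "'a set"
    and M :: "nat \<Rightarrow> 'a set"
    and l k q :: nat
    and V L :: "'a \<Rightarrow> real"
    and a b c \<alpha> \<beta> c' :: real
  assumes "semiflow S" and "asymptotically_compact S"
    and "attractor S \<A>" and "\<Omega> = attraction_basin S \<A>"
    and "morse_decomposition S \<A> l M"
    and "1 \<le> k" and "k \<le> l"
    and "strict_morse_lyapunov S l M \<Omega> V" and "strict_morse_lyapunov S l M \<Omega> L"
    and "c = const_value V (M k)" and "c' = const_value L (M k)"
    and "a < c" and "c < b" and "\<alpha> < c'" and "c' < \<beta>"
    and "critical_values l M V \<inter> {a..b} = {c}"
    and "critical_values l M L \<inter> {\<alpha>..\<beta>} = {c'}"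
  shows "relative_homology_group_coeff TYPE('g::ab_group_add) q
            (top_of_set (sublevel \<Omega> V b)) (sublevel \<Omega> V a)
       \<cong> relative_homology_group_coeff TYPE('g) q
            (top_of_set (sublevel \<Omega> L \<beta>)) (sublevel \<Omega> L \<alpha>)"
proof -
  have attr: "compact \<A>" "flow_invariant S \<A>"
    using assms(3) by (auto simp: attractor_in_def)
  have lyap: "morse_lyapunov S l M (attraction_basin S \<A>) V" "morse_lyapunov S l M (attraction_basin S \<A>) L"
    using assms(4,8,9) by (auto simp: strict_morse_lyapunov_def)
  \<comment> \<open>By strictness the value of M j is below that of M k for j < k and above it for j
    > k. It cannot lie in [u, v], so it is below u or above v. Both weak and strict forms are
    recorded, since \<open>crit\<close> uses one for each function and the roles are
    exchanged.\<close>
  have order: "(const_value W (M j) \<le> u \<longleftrightarrow> j < k) \<and> (const_value W (M j) < u \<longleftrightarrow> j < k) \<and>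
      (const_value W (M j) \<le> v \<longleftrightarrow> j \<le> k) \<and> (const_value W (M j) < v \<longleftrightarrow> j \<le> k)"
    if W: "strict_morse_lyapunov S l M \<Omega> W" "critical_values l M W \<inter> {u..v} = {const_value W (M k)}"
      and uv: "u < const_value W (M k)" "const_value W (M k) < v" and j: "j \<in> {1..l}" for W u v j
  proof -
    let ?w = "\<lambda>j. const_value W (M j)"
    have mono: "?w i < ?w j" if "i < j" "i \<in> {1..l}" "j \<in> {1..l}" for i j
      using W(1) that monotone_onD [of "{1..l}" "(<)" "(<)" ?w] by (simp add: strict_morse_lyapunov_def)
    have k: "k \<in> {1..l}"
      using assms(6,7) by simp
    have same: "?w j = ?w k" if "u \<le> ?w j" "?w j \<le> v"
    proof -
      have "?w j \<in> critical_values l M W \<inter> {u..v}"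
        using j that by (simp add: critical_values_def)
      then show ?thesis
        unfolding W(2) by simp
    qed
    consider "j < k" "?w j < ?w k" | "j = k" | "k < j" "?w k < ?w j"
      using mono [OF _ j k] mono [OF _ k j] by linarith
    then show ?thesis
      by cases (use same uv in \<open>force simp: not_le not_less\<close>)+
  qed
  note V = order [OF assms(8) assms(16,12,13) [unfolded assms(10)]]
  note L = order [OF assms(9) assms(17,14,15) [unfolded assms(11)]]
  let ?H = "\<lambda>X A. relative_homology_group_coeff TYPE('g) q (top_of_set X) A"
  let ?I = "?H (sublevel \<Omega> V b \<inter> sublevel \<Omega> L \<beta>) (sublevel \<Omega> V a \<inter> sublevel \<Omega> L \<alpha>)"
  \<comment> \<open>By \<open>order\<close>, both sides of \<open>crit\<close> amount to j \<le> k
    at the upper levels and to j < k at the lower ones.\<close>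
  have "?I \<cong> ?H (sublevel \<Omega> V b) (sublevel \<Omega> V a)"
    unfolding assms(4)
    by (rule relative_homology_group_coeff_sublevel_Int_iso [OF assms(1) attr assms(5) lyap])
      (use V L assms(12-15) in auto)
  then have "?H (sublevel \<Omega> V b) (sublevel \<Omega> V a) \<cong> ?I"
    by (rule group.iso_sym [OF group_relative_homology_group_coeff])
  \<comment> \<open>Commuting the intersections allows the same lemma with V and L
    exchanged.\<close>
  also have "?I = ?H (sublevel \<Omega> L \<beta> \<inter> sublevel \<Omega> V b) (sublevel \<Omega> L \<alpha> \<inter> sublevel \<Omega> V a)"
    by (simp only: Int_commute)
  also have "\<dots> \<cong> ?H (sublevel \<Omega> L \<beta>) (sublevel \<Omega> L \<alpha>)"
    unfolding assms(4)
    by (rule relative_homology_group_coeff_sublevel_Int_iso [OF assms(1) attr assms(5) lyap(2,1)])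
      (use V L assms(12-15) in auto)
  finally show ?thesis .
qed

end
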